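(* Let $c\geq 0$ be an integer and let $G$ be a (topologically) finitely generated infinite profinite group that has no non-trivial abelian closed normal subgroup. Then $G$ is JNN$_c$F if and only if, for every open subgroup $H$ of $G$, the set $$\mathcal{A}_H=\{\gamma_{c+1}(K)\mid K \text{ an open normal subgroup of } G \text{ with } \gamma_{c+1}(K)\not\leq H\}$$ is finite.
   Context: For closed subgroups $K,L$ of a profinite group, $[K,L]$ denotes the closed subgroup generated by all commutators $[x,y]$ with $x\in K$, $y\in L$. The lower central series is $\gamma_1(K)=K$, $\gamma_{i+1}(K)=[\gamma_i(K),K]$. A profinite group is virtually class-$c$ nilpotent if it has a subgroup $H$ of finite index (equivalently, an open subgroup $H$) with $\gamma_{c+1}(H)=1$. A profinite group $G$ is JNN$_c$F (just non-(class-$c$-nilpotent-by-finite)) if $G$ is not virtually class-$c$ nilpotent but $G/N$ is virtually class-$c$ nilpotent for every non-trivial closed normal subgroup $N$ of $G$. *)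

theory Defs
  imports "HOL-Algebra.Algebra" "HOL-Analysis.Abstract_Topology_2" "HOL-Analysis.Product_Topology"
begin

text \<open>
  Profinite groups are rendered intrinsically, as compact Hausdorff totally disconnected topological
  groups. The topology \<open>T\<close> is a separate argument whose points are the elements of the carrier.
\<close>

locale profinite_group = group G for G (structure) +
  fixes T :: "'a topology"
  assumes topspace_eq: "topspace T = carrier G"
    and continuous_mult: "continuous_map (prod_topology T T) T (\<lambda>(x, y). x \<otimes> y)"
    and continuous_inv: "continuous_map T T (\<lambda>x. inv x)"
    and compact: "compact_space T"
    and Hausdorff: "Hausdorff_space T"
    and totally_disconnected: "\<And>S. connectedin T S \<Longrightarrow> \<exists>x. S \<subseteq> {x}"

definition open_subgroup :: "('a, 'b) monoid_scheme \<Rightarrow> 'a topology \<Rightarrow> 'a set \<Rightarrow> bool" where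
  "open_subgroup G T H \<longleftrightarrow> subgroup H G \<and> openin T H"

definition open_normal :: "('a, 'b) monoid_scheme \<Rightarrow> 'a topology \<Rightarrow> 'a set \<Rightarrow> bool" where
  "open_normal G T N \<longleftrightarrow> N \<lhd> G \<and> openin T N"

definition closed_normal :: "('a, 'b) monoid_scheme \<Rightarrow> 'a topology \<Rightarrow> 'a set \<Rightarrow> bool" where
  "closed_normal G T N \<longleftrightarrow> N \<lhd> G \<and> closedin T N"

definition closed_generate :: "('a, 'b) monoid_scheme \<Rightarrow> 'a topology \<Rightarrow> 'a set \<Rightarrow> 'a set" where
  "closed_generate G T S = T closure_of (generate G S)"

definition topologically_fg :: "('a, 'b) monoid_scheme \<Rightarrow> 'a topology \<Rightarrow> bool" where
  "topologically_fg G T \<longleftrightarrow>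
     (\<exists>S. finite S \<and> S \<subseteq> carrier G \<and> closed_generate G T S = carrier G)"

text \<open>
  For subgroups \<open>K\<close>, \<open>L\<close> the choice between \<open>x y x\<^sup>-\<^sup>1 y\<^sup>-\<^sup>1\<close> and \<open>x\<^sup>-\<^sup>1 y\<^sup>-\<^sup>1 x y\<close> is immaterial: both yield the same
  set of commutators. The order used here agrees with the constant \<open>derived_set\<close> of HOL-Algebra.
\<close>

definition closed_commutator ::
    "('a, 'b) monoid_scheme \<Rightarrow> 'a topology \<Rightarrow> 'a set \<Rightarrow> 'a set \<Rightarrow> 'a set" where
  "closed_commutator G T K L = closed_generate G T
     {x \<otimes>\<^bsub>G\<^esub> y \<otimes>\<^bsub>G\<^esub> inv\<^bsub>G\<^esub> x \<otimes>\<^bsub>G\<^esub> inv\<^bsub>G\<^esub> y | x y. x \<in> K \<and> y \<in> L}"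

text \<open>The series starts at index 1; the value at index 0 is a dummy.\<close>

fun lower_central ::
    "('a, 'b) monoid_scheme \<Rightarrow> 'a topology \<Rightarrow> nat \<Rightarrow> 'a set \<Rightarrow> 'a set" where
  "lower_central G T 0 K = K"
| "lower_central G T (Suc 0) K = K"
| "lower_central G T (Suc (Suc i)) K = closed_commutator G T (lower_central G T (Suc i) K) K"

text \<open>
  The subgroup \<open>H\<close> is asked to be open: a closed subgroup of a compact topological group has finite index exactly if it is open.
\<close>

definition virtually_nilpotent ::
    "nat \<Rightarrow> ('a, 'b) monoid_scheme \<Rightarrow> 'a topology \<Rightarrow> bool" where
  "virtually_nilpotent c G T \<longleftrightarrow>
     (\<exists>H. open_subgroup G T H \<and> lower_central G T (c + 1) H = {\<one>\<^bsub>G\<^esub>})"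

definition quotient_topology ::
    "('a, 'b) monoid_scheme \<Rightarrow> 'a topology \<Rightarrow> 'a set \<Rightarrow> 'a set topology" where
  "quotient_topology G T N = topology (\<lambda>U. U \<subseteq> carrier (G Mod N) \<and>
     openin T {x \<in> topspace T. N #>\<^bsub>G\<^esub> x \<in> U})"

lemma openin_quotient_topology:
  "openin (quotient_topology G T N) U \<longleftrightarrow>
     U \<subseteq> carrier (G Mod N) \<and> openin T {x \<in> topspace T. N #>\<^bsub>G\<^esub> x \<in> U}"
proof -
  let ?P = "\<lambda>U. U \<subseteq> carrier (G Mod N) \<and> openin T {x \<in> topspace T. N #>\<^bsub>G\<^esub> x \<in> U}"
  have "istopology ?P"
    unfolding istopology_def
  proof (intro conjI allI impI)
    fix U V assume UV: "?P U" "?P V"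
    then show "U \<inter> V \<subseteq> carrier (G Mod N)" by blast
    have "{x \<in> topspace T. N #>\<^bsub>G\<^esub> x \<in> U \<inter> V} =
        {x \<in> topspace T. N #>\<^bsub>G\<^esub> x \<in> U} \<inter> {x \<in> topspace T. N #>\<^bsub>G\<^esub> x \<in> V}"
      by blast
    then show "openin T {x \<in> topspace T. N #>\<^bsub>G\<^esub> x \<in> U \<inter> V}"
      using UV by (simp add: openin_Int)
  next
    fix \<U> assume \<U>: "\<forall>U\<in>\<U>. ?P U"
    then show "\<Union>\<U> \<subseteq> carrier (G Mod N)" by blast
    have "{x \<in> topspace T. N #>\<^bsub>G\<^esub> x \<in> \<Union>\<U>} = (\<Union>U\<in>\<U>. {x \<in> topspace T. N #>\<^bsub>G\<^esub> x \<in> U})"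
      by blast
    then show "openin T {x \<in> topspace T. N #>\<^bsub>G\<^esub> x \<in> \<Union>\<U>}"
      using \<U> by (simp only:) (blast intro: openin_Union)
  qed
  then show ?thesis
    by (simp add: quotient_topology_def topology_inverse')
qed

lemma quotient_map_quotient_topology:
  assumes "topspace T = carrier G"
  shows "quotient_map T (quotient_topology G T N) (\<lambda>x. N #>\<^bsub>G\<^esub> x)"
proof -
  have img: "(\<lambda>x. N #>\<^bsub>G\<^esub> x) ` topspace T = carrier (G Mod N)"
    using assms by (auto simp: FactGroup_def RCOSETS_def)
  then have "{x \<in> topspace T. N #>\<^bsub>G\<^esub> x \<in> carrier (G Mod N)} = topspace T"
    by blast
  then have "openin (quotient_topology G T N) (carrier (G Mod N))"
    by (simp add: openin_quotient_topology)
  then have "topspace (quotient_topology G T N) = carrier (G Mod N)"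
    by (meson openin_quotient_topology openin_subset openin_topspace subset_antisym)
  then show ?thesis
    by (simp add: quotient_map_def img openin_quotient_topology)
qed

definition JNNF :: "nat \<Rightarrow> ('a, 'b) monoid_scheme \<Rightarrow> 'a topology \<Rightarrow> bool" where
  "JNNF c G T \<longleftrightarrow> \<not> virtually_nilpotent c G T \<and>
     (\<forall>N. closed_normal G T N \<and> N \<noteq> {\<one>\<^bsub>G\<^esub>} \<longrightarrow>
        virtually_nilpotent c (G Mod N) (quotient_topology G T N))"

end

theory Submission
  imports Defs "HOL-Analysis.Abstract_Topological_Spaces"
begin

text \<open>
  Write \<open>g(K)\<close> for \<open>\<gamma>\<^sub>c\<^sub>+\<^sub>1(K)\<close>. If all sets \<open>\<A>\<^sub>H\<close> are finite and \<open>N\<close> is a non-trivial closed normal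
  subgroup, choose \<open>H\<close> not containing \<open>g(N)\<close>: only finitely many groups \<open>g(K)\<close> with \<open>N \<le> K\<close> occur, so one
  of them is contained in all such \<open>K\<close>, hence in \<open>N\<close>.

  Conversely, let \<open>G\<close> be JNN\<open>\<^sub>c\<close>F. First, for \<open>N \<noteq> 1\<close> only finitely many groups \<open>g(K) N\<close> exist: if
  \<open>g(V) \<le> N\<close> with \<open>V\<close> open and \<open>E = K V\<close> (finitely many possibilities), then Fitting's theorem gives
  \<open>\<gamma>\<^sub>2\<^sub>c\<^sub>+\<^sub>1(E) \<le> g(K) N \<le> g(E) N\<close>. The factors \<open>\<gamma>\<^sub>i(E) / \<gamma>\<^sub>i\<^sub>+\<^sub>1(E)\<close> with \<open>i > c\<close> are modulo \<open>N\<close> finitely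
  generated abelian groups of finite exponent: \<open>\<gamma>\<^sub>i(V) \<le> N\<close>, and by multilinearity \<open>\<gamma>\<^sub>i(V)\<close> contains
  powers of the generating commutators. Second, every closed normal \<open>L \<noteq> 1\<close> contains some \<open>N \<noteq> 1\<close>
  that is not properly supplemented, i.e. \<open>A N = L\<close> implies \<open>A = L\<close>. Now if \<open>\<A>\<^sub>H\<close> is infinite, then
  by compactness and the first fact there is a closed normal \<open>L\<close> minimal among those that contain
  infinitely many members of \<open>\<A>\<^sub>H\<close>. By the first fact and minimality, \<open>A N = L\<close> for infinitely many
  such members \<open>A\<close>, and the second fact gives \<open>A = L\<close> for all of them.
\<close>

section \<open>Commutators and profinite topology\<close>

text \<open>Zorn's lemma for descending chains: passing to complements turns intersections into
  unions and minimal members into maximal ones.\<close>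

lemma minimal_member_if_chains_closed:
  assumes "\<A> \<noteq> {}"
    and "\<And>\<C>. \<lbrakk>\<C> \<noteq> {}; \<C> \<subseteq> \<A>; (\<forall>A\<in>\<C>. \<forall>B\<in>\<C>. A \<subseteq> B \<or> B \<subseteq> A)\<rbrakk> \<Longrightarrow> \<Inter>\<C> \<in> \<A>"
  obtains M where "M \<in> \<A>" "\<And>A. \<lbrakk>A \<in> \<A>; A \<subseteq> M\<rbrakk> \<Longrightarrow> A = M"
proof -
  have "\<exists>M\<in>uminus ` \<A>. \<forall>A\<in>uminus ` \<A>. M \<subseteq> A \<longrightarrow> A = M"
  proof (rule subset_Zorn_nonempty)
    fix \<C> assume ne: "\<C> \<noteq> {}" and ch: "subset.chain (uminus ` \<A>) \<C>"
    have "\<Inter>(uminus ` \<C>) \<in> \<A>"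
    proof (rule assms(2))
      show "uminus ` \<C> \<subseteq> \<A>" using ch by (auto simp: subset.chain_def)
      show "\<forall>A\<in>uminus ` \<C>. \<forall>B\<in>uminus ` \<C>. A \<subseteq> B \<or> B \<subseteq> A"
        using ch by (fastforce simp: subset.chain_def)
    qed (use ne in auto)
    moreover have "\<Union>\<C> = - \<Inter>(uminus ` \<C>)" by auto
    ultimately show "\<Union>\<C> \<in> uminus ` \<A>" by blast
  qed (use assms(1) in auto)
  then obtain M where "M \<in> \<A>" and M: "\<And>A. A \<in> \<A> \<Longrightarrow> - M \<subseteq> - A \<Longrightarrow> - A = - M"
    by auto
  then show thesis
    using that[of M] by (metis Compl_subset_Compl_iff double_compl)
qed

definition commutator :: "('a, 'b) monoid_scheme \<Rightarrow> 'a \<Rightarrow> 'a \<Rightarrow> 'a" where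
  "commutator G x y = x \<otimes>\<^bsub>G\<^esub> y \<otimes>\<^bsub>G\<^esub> inv\<^bsub>G\<^esub> x \<otimes>\<^bsub>G\<^esub> inv\<^bsub>G\<^esub> y"

lemma closed_commutator_eq:
  "closed_commutator G T K L = closed_generate G T {commutator G x y |x y. x \<in> K \<and> y \<in> L}"
  by (simp add: closed_commutator_def commutator_def)

section \<open>Commutator identities and products of subsets in abstract groups\<close>

context group
begin

abbreviation cmt :: "'a \<Rightarrow> 'a \<Rightarrow> 'a" where
  "cmt x y \<equiv> commutator G x y"

lemma inv_cancel_left [simp]:
  assumes "x \<in> carrier G" "y \<in> carrier G"
  shows "inv x \<otimes> (x \<otimes> y) = y" "x \<otimes> (inv x \<otimes> y) = y"
  using assms by (simp_all flip: m_assoc)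

lemma commutator_closed [simp]:
  "\<lbrakk>x \<in> carrier G; y \<in> carrier G\<rbrakk> \<Longrightarrow> cmt x y \<in> carrier G"
  by (simp add: commutator_def)

lemma commutator_one [simp]:
  assumes "x \<in> carrier G"
  shows "cmt \<one> x = \<one>" "cmt x \<one> = \<one>"
  using assms by (simp_all add: commutator_def)

lemma commutator_mult_left:
  "\<lbrakk>x \<in> carrier G; y \<in> carrier G; z \<in> carrier G\<rbrakk> \<Longrightarrow>
    cmt (x \<otimes> y) z = (x \<otimes> cmt y z \<otimes> inv x) \<otimes> cmt x z"
  by (simp add: commutator_def m_assoc inv_mult_group)

lemma commutator_mult_right:
  "\<lbrakk>x \<in> carrier G; y \<in> carrier G; z \<in> carrier G\<rbrakk> \<Longrightarrow>
    cmt x (y \<otimes> z) = cmt x y \<otimes> (y \<otimes> cmt x z \<otimes> inv y)"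
  by (simp add: commutator_def m_assoc inv_mult_group)

lemma inv_commutator:
  "\<lbrakk>x \<in> carrier G; y \<in> carrier G\<rbrakk> \<Longrightarrow> inv (cmt x y) = cmt y x"
  by (simp add: commutator_def m_assoc inv_mult_group)

lemma commutator_inv_left:
  "\<lbrakk>x \<in> carrier G; y \<in> carrier G\<rbrakk> \<Longrightarrow> cmt (inv x) y = inv x \<otimes> cmt y x \<otimes> x"
  by (simp add: commutator_def m_assoc inv_mult_group)

lemma commutator_conj:
  "\<lbrakk>x \<in> carrier G; y \<in> carrier G; g \<in> carrier G\<rbrakk> \<Longrightarrow>
    g \<otimes> cmt x y \<otimes> inv g = cmt (g \<otimes> x \<otimes> inv g) (g \<otimes> y \<otimes> inv g)"
  by (simp add: commutator_def m_assoc inv_mult_group)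

lemma conj_eq_commutator_mult:
  "\<lbrakk>x \<in> carrier G; y \<in> carrier G\<rbrakk> \<Longrightarrow> x \<otimes> y \<otimes> inv x = cmt x y \<otimes> y"
  by (simp add: commutator_def m_assoc inv_mult_group)

lemma mult_eq_commutator_mult:
  "\<lbrakk>x \<in> carrier G; y \<in> carrier G\<rbrakk> \<Longrightarrow> x \<otimes> y = cmt x y \<otimes> (y \<otimes> x)"
  by (simp add: commutator_def m_assoc inv_mult_group)

lemma commutator_eq_one_iff:
  assumes "x \<in> carrier G" "y \<in> carrier G"
  shows "cmt x y = \<one> \<longleftrightarrow> x \<otimes> y = y \<otimes> x"
proof -
  have "cmt x y = \<one> \<longleftrightarrow> cmt x y \<otimes> (y \<otimes> x) = \<one> \<otimes> (y \<otimes> x)"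
    using assms by (subst right_cancel) auto
  also have "\<dots> \<longleftrightarrow> x \<otimes> y = y \<otimes> x"
    using assms by (simp flip: mult_eq_commutator_mult)
  finally show ?thesis .
qed

lemma normal_conj:
  "\<lbrakk>N \<lhd> G; x \<in> carrier G; h \<in> N\<rbrakk> \<Longrightarrow> x \<otimes> h \<otimes> inv x \<in> N"
  by (rule normal_invE(2))

lemma normal_conj_inv:
  "\<lbrakk>N \<lhd> G; x \<in> carrier G; h \<in> N\<rbrakk> \<Longrightarrow> inv x \<otimes> h \<otimes> x \<in> N"
  by (rule normal.inv_op_closed1)

lemma normal_subset: "N \<lhd> G \<Longrightarrow> N \<subseteq> carrier G"
  by (simp add: normal_imp_subgroup subgroup.subset)

lemma commutator_in_normal_left:
  assumes "N \<lhd> G" "x \<in> N" "y \<in> carrier G"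
  shows "cmt x y \<in> N"
proof -
  have x: "x \<in> carrier G" using assms normal_subset by blast
  have "cmt x y = x \<otimes> (y \<otimes> inv x \<otimes> inv y)"
    using x assms(3) by (simp add: commutator_def m_assoc)
  moreover have "inv x \<in> N" using assms by (simp add: normal_imp_subgroup subgroup.m_inv_closed)
  ultimately show ?thesis
    using assms normal_conj[OF assms(1,3)] by (simp add: normal_imp_subgroup subgroup.m_closed)
qed

lemma commutator_in_normal_right:
  assumes "N \<lhd> G" "x \<in> carrier G" "y \<in> N"
  shows "cmt x y \<in> N"
  using commutator_in_normal_left[OF assms(1,3,2)] assms normal_subset
  by (metis inv_commutator normal_imp_subgroup subgroup.m_inv_closed subsetD)

lemma set_multI: "\<lbrakk>a \<in> A; b \<in> B\<rbrakk> \<Longrightarrow> a \<otimes> b \<in> A <#> B"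
  by (auto simp: set_mult_def)

lemma set_multE:
  assumes "x \<in> A <#> B"
  obtains a b where "a \<in> A" "b \<in> B" "x = a \<otimes> b"
  using assms by (auto simp: set_mult_def)

lemma subset_set_mult_left: "\<lbrakk>A \<subseteq> carrier G; \<one> \<in> B\<rbrakk> \<Longrightarrow> A \<subseteq> A <#> B"
  by (force simp: set_mult_def)

lemma subset_set_mult_right: "\<lbrakk>B \<subseteq> carrier G; \<one> \<in> A\<rbrakk> \<Longrightarrow> B \<subseteq> A <#> B"
  by (force simp: set_mult_def)

lemma set_mult_subset_subgroup:
  "\<lbrakk>A \<subseteq> H; B \<subseteq> H; subgroup H G\<rbrakk> \<Longrightarrow> A <#> B \<subseteq> H"
  by (auto simp: set_mult_def intro: subgroup.m_closed)

end

lemma (in group) normal_Inter: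
  assumes "\<A> \<noteq> {}" "\<And>N. N \<in> \<A> \<Longrightarrow> N \<lhd> G"
  shows "\<Inter>\<A> \<lhd> G"
proof (rule normal_invI)
  show "subgroup (\<Inter>\<A>) G"
    using assms by (intro subgroups_Inter) (auto simp: normal_imp_subgroup)
qed (use assms normal_conj in blast)

section \<open>Compactness, open subgroups and the neighbourhood basis at the identity\<close>

context profinite_group
begin

lemma continuous_map_mult:
  assumes "continuous_map S T f" "continuous_map S T g"
  shows "continuous_map S T (\<lambda>x. f x \<otimes> g x)"
  using continuous_map_compose[OF continuous_map_pairedI[OF assms] continuous_mult]
  by (simp add: o_def)

lemma continuous_map_m_inv:
  "continuous_map S T f \<Longrightarrow> continuous_map S T (\<lambda>x. inv (f x))"
  using continuous_map_compose[OF _ continuous_inv] by (simp add: o_def)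

lemma continuous_map_const_carrier:
  "a \<in> carrier G \<Longrightarrow> continuous_map S T (\<lambda>x. a)"
  by (simp add: topspace_eq)

lemma continuous_map_commutator:
  assumes "continuous_map S T f" "continuous_map S T g"
  shows "continuous_map S T (\<lambda>x. commutator G (f x) (g x))"
  unfolding commutator_def by (intro continuous_map_mult continuous_map_m_inv assms)

lemmas continuous_intros_group =
  continuous_map_mult continuous_map_m_inv continuous_map_const_carrier continuous_map_commutator
  continuous_map_id[unfolded id_def]

lemma closedin_preimage:
  assumes "continuous_map T T f" "closedin T A"
  shows "closedin T {x \<in> carrier G. f x \<in> A}"
  using closedin_continuous_map_preimage[OF assms] by (simp add: topspace_eq)

lemma openin_preimage:
  assumes "continuous_map T T f" "openin T A"
  shows "openin T {x \<in> carrier G. f x \<in> A}"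
  using openin_continuous_map_preimage[OF assms] by (simp add: topspace_eq)

lemma closedin_subset_carrier: "closedin T A \<Longrightarrow> A \<subseteq> carrier G"
  using closedin_subset topspace_eq by blast

lemma openin_subset_carrier: "openin T A \<Longrightarrow> A \<subseteq> carrier G"
  using openin_subset topspace_eq by blast

lemma closedin_one: "closedin T {\<one>}"
  by (simp add: Hausdorff closedin_Hausdorff_sing_eq topspace_eq)

text \<open>\<open>A <#> B\<close> is the image of the compact set \<open>A \<times> B\<close> under
  multiplication, and compact sets are closed in a Hausdorff space.\<close>

lemma closedin_set_mult:
  assumes "closedin T A" "closedin T B"
  shows "closedin T (A <#> B)"
proof -
  have "compactin (prod_topology T T) (A \<times> B)"
    using assms compact by (simp add: compactin_Times closedin_compact_space)
  then have "compactin T ((\<lambda>(x, y). x \<otimes> y) ` (A \<times> B))"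
    by (rule image_compactin[OF _ continuous_mult])
  moreover have "(\<lambda>(x, y). x \<otimes> y) ` (A \<times> B) = A <#> B"
    by (auto simp: set_mult_def)
  ultimately show ?thesis
    by (simp add: Hausdorff compactin_imp_closedin)
qed

lemma openin_translate:
  assumes "openin T A" "a \<in> carrier G"
  shows "openin T {x \<in> carrier G. a \<otimes> x \<in> A}"
  using assms by (intro openin_preimage continuous_intros_group)

lemma open_superset_subgroup:
  assumes "subgroup H G" "openin T U" "U \<subseteq> H" "\<one> \<in> U"
  shows "openin T H"
proof (subst openin_subopen, intro ballI)
  fix h assume h: "h \<in> H"
  then have hc: "h \<in> carrier G" using assms(1) subgroup.subset by blast
  let ?W = "{x \<in> carrier G. inv h \<otimes> x \<in> U}"
  have "?W \<subseteq> H"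
  proof
    fix x assume x: "x \<in> ?W"
    then have "h \<otimes> (inv h \<otimes> x) \<in> H"
      using h assms by (blast intro: subgroup.m_closed)
    then show "x \<in> H" using x hc by simp
  qed
  moreover have "openin T ?W" using assms(2) hc by (intro openin_translate) auto
  moreover have "h \<in> ?W" using hc assms(4) by simp
  ultimately show "\<exists>S. openin T S \<and> h \<in> S \<and> S \<subseteq> H" by blast
qed

text \<open>Compactness applied to the cover by the open left cosets \<open>a H\<close>;
  \<open>F\<close> collects representatives of a finite subcover.\<close>

lemma finite_cover_open_subgroup:
  assumes "subgroup H G" "openin T H"
  obtains F where "finite F" "F \<subseteq> carrier G" "carrier G = F <#> H"
proof -
  let ?c = "\<lambda>a. {x \<in> carrier G. inv a \<otimes> x \<in> H}"
  have cov: "carrier G \<subseteq> (\<Union>a\<in>carrier G. ?c a)"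
    using subgroup.one_closed[OF assms(1)] by auto
  have "openin T (?c a)" if "a \<in> carrier G" for a
    using that assms(2) by (intro openin_translate) auto
  then have op: "\<forall>U\<in>?c ` carrier G. openin T U" by blast
  from compact[unfolded compact_space_alt, rule_format, of "?c ` carrier G"] op cov
  obtain \<F> where \<F>: "finite \<F>" "\<F> \<subseteq> ?c ` carrier G" "carrier G \<subseteq> \<Union>\<F>"
    by (auto simp: topspace_eq)
  then obtain F where F: "F \<subseteq> carrier G" "finite F" "\<F> = ?c ` F"
    using finite_subset_image by meson
  have "carrier G \<subseteq> F <#> H"
  proof
    fix x assume x: "x \<in> carrier G"
    then obtain a where a: "a \<in> F" "inv a \<otimes> x \<in> H" using F \<F>(3) by auto
    then have "a \<otimes> (inv a \<otimes> x) \<in> F <#> H" by (intro set_multI)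
    then show "x \<in> F <#> H" using a x F by (auto simp: subset_iff)
  qed
  moreover have "F <#> H \<subseteq> carrier G"
    using F assms(1) subgroup.subset by (meson setmult_subset_G)
  ultimately show thesis using that F by blast
qed

lemma open_subgroup_closed:
  assumes "subgroup H G" "openin T H"
  shows "closedin T H"
proof -
  have "carrier G - H = (\<Union>a\<in>carrier G - H. {x \<in> carrier G. inv a \<otimes> x \<in> H})" (is "_ = ?R")
  proof
    show "carrier G - H \<subseteq> ?R" using subgroup.one_closed[OF assms(1)] by auto
    show "?R \<subseteq> carrier G - H"
    proof clarify
      fix a x assume *: "a \<in> carrier G" "a \<notin> H" "x \<in> carrier G" "inv a \<otimes> x \<in> H" "x \<in> H"
      then have "x \<otimes> inv (inv a \<otimes> x) \<in> H"
        using assms(1) by (simp add: subgroup.m_closed subgroup.m_inv_closed)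
      moreover have "x \<otimes> inv (inv a \<otimes> x) = a"
        using * by (simp add: inv_mult_group)
      ultimately show False using * by simp
    qed
  qed
  moreover have "openin T ?R"
    using assms(2) by (intro openin_Union) (auto intro!: openin_translate)
  ultimately show ?thesis
    using assms(1) subgroup.subset by (metis closedin_def topspace_eq)
qed

text \<open>The normal core of \<open>H\<close> stays open because it is already an intersection of
  finitely many conjugates.\<close>

lemma open_normal_core:
  assumes "subgroup H G" "openin T H"
  obtains U where "open_normal G T U" "U \<subseteq> H"
proof -
  obtain F where F: "finite F" "F \<subseteq> carrier G" "carrier G = F <#> H"
    using finite_cover_open_subgroup assms by blast
  define U where "U = {x \<in> carrier G. \<forall>g\<in>carrier G. inv g \<otimes> x \<otimes> g \<in> H}"
  \<comment> \<open>Writing \<open>g = f \<otimes> h\<close> with \<open>h \<in> H\<close>, the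
    condition for \<open>g\<close> follows from the one for \<open>f\<close>, so the representatives
    in \<open>F\<close> suffice.\<close>
  have fin: "U = carrier G \<inter> (\<Inter>f\<in>F. {x \<in> carrier G. inv f \<otimes> x \<otimes> f \<in> H})"
  proof (intro equalityI subsetI)
    fix x assume x: "x \<in> carrier G \<inter> (\<Inter>f\<in>F. {x \<in> carrier G. inv f \<otimes> x \<otimes> f \<in> H})"
    show "x \<in> U" unfolding U_def
    proof (intro CollectI conjI ballI)
      fix g assume "g \<in> carrier G"
      then obtain f h where fh: "f \<in> F" "h \<in> H" "g = f \<otimes> h"
        using F by (auto elim: set_multE)
      then have "f \<in> carrier G" "h \<in> carrier G"
        using F(2) subgroup.subset[OF assms(1)] by blast+
      moreover have "inv f \<otimes> x \<otimes> f \<in> H" using x fh by auto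
      then have "inv h \<otimes> (inv f \<otimes> x \<otimes> f) \<otimes> h \<in> H"
        using fh assms(1) by (simp add: subgroup.m_closed subgroup.m_inv_closed)
      ultimately show "inv g \<otimes> x \<otimes> g \<in> H"
        using x fh by (simp add: inv_mult_group m_assoc)
    qed (use x in auto)
  qed (use F in \<open>auto simp: U_def\<close>)
  have "openin T {x \<in> carrier G. inv f \<otimes> x \<otimes> f \<in> H}" if "f \<in> F" for f
    using that F assms(2) by (intro openin_preimage continuous_intros_group) auto
  then have op: "openin T U"
    unfolding fin using F(1) openin_topspace[of T]
    by (cases "F = {}") (auto simp: topspace_eq intro!: openin_Int openin_INT2)
  have sub: "subgroup U G"
  proof (rule subgroupI)
    show "U \<noteq> {}" using subgroup.one_closed[OF assms(1)] by (auto simp: U_def intro!: exI[of _ \<one>])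
    fix a assume a: "a \<in> U"
    have "inv g \<otimes> inv a \<otimes> g = inv (inv g \<otimes> a \<otimes> g)" if "g \<in> carrier G" for g
      using a that by (simp add: U_def inv_mult_group m_assoc)
    then show "inv a \<in> U"
      using a assms(1) by (auto simp: U_def subgroup.m_inv_closed)
    fix b assume b: "b \<in> U"
    have "inv g \<otimes> (a \<otimes> b) \<otimes> g = (inv g \<otimes> a \<otimes> g) \<otimes> (inv g \<otimes> b \<otimes> g)" if "g \<in> carrier G" for g
      using a b that by (simp add: U_def m_assoc)
    then show "a \<otimes> b \<in> U"
      using a b assms(1) by (auto simp: U_def subgroup.m_closed)
  qed (auto simp: U_def)
  have "U \<lhd> G"
  proof (rule normal_invI[OF sub])
    fix x h assume xh: "x \<in> carrier G" "h \<in> U"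
    have "inv g \<otimes> (x \<otimes> h \<otimes> inv x) \<otimes> g = inv (inv x \<otimes> g) \<otimes> h \<otimes> (inv x \<otimes> g)"
      if "g \<in> carrier G" for g
      using xh that by (simp add: U_def m_assoc inv_mult_group)
    then show "x \<otimes> h \<otimes> inv x \<in> U" using xh by (simp add: U_def)
  qed
  moreover have "U \<subseteq> H"
    unfolding U_def using one_closed by (force dest: bspec[of _ _ \<one>])
  ultimately show thesis using that op by (auto simp: open_normal_def)
qed

text \<open>Van Dantzig's theorem: a clopen neighbourhood of \<open>\<one>\<close> inside
  \<open>W\<close> contains an open subgroup, generated by elements whose right translations map
  that neighbourhood into itself. \<open>open_normal_core\<close> then supplies a normal
  one.\<close>

lemma open_normal_basis:
  assumes "openin T W" "\<one> \<in> W"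
  obtains U where "open_normal G T U" "U \<subseteq> W"
proof -
  \<comment> \<open>Connected sets are at most singletons, so none meets both
    \<open>{\<one>}\<close> and the complement of \<open>W\<close>; in a compact Hausdorff space
    this yields a separation by two open sets.\<close>
  have "separated_between T {\<one>} (carrier G - W)"
  proof (rule cut_wire_fence_theorem)
    show "compact_space T" "Hausdorff_space T" "closedin T {\<one>}"
      by (simp_all add: compact Hausdorff closedin_one)
    show "closedin T (carrier G - W)" using assms(1) topspace_eq by (metis closedin_diff closedin_topspace)
    show "disjnt C {\<one>} \<or> disjnt C (carrier G - W)" if "connectedin T C" for C
      using totally_disconnected[OF that] assms(2) by (auto simp: disjnt_def)
  qed
  then obtain C D where CD: "openin T C" "openin T D" "C \<union> D = carrier G" "disjnt C D" "\<one> \<in> C"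
      "carrier G - W \<subseteq> D"
    by (auto simp: separated_between_def topspace_eq)
  then have CW: "C \<subseteq> W" using openin_subset_carrier by (fastforce simp: disjnt_def)
  have C: "C = carrier G - D" using CD openin_subset_carrier by (fastforce simp: disjnt_def)
  have clC: "closedin T C" unfolding C using CD(2) topspace_eq by (metis closedin_diff closedin_topspace)
  \<comment> \<open>\<open>V\<close> contains a neighbourhood of \<open>\<one>\<close> by the tube
    argument: multiplication sends the compact set \<open>C \<times> {\<one>}\<close> into the open
    set \<open>C\<close>.\<close>
  define V where "V = {x \<in> carrier G. \<forall>c\<in>C. c \<otimes> x \<in> C}"
  have "\<exists>N. openin T N \<and> \<one> \<in> N \<and> N \<subseteq> V"
  proof -
    have op: "openin (prod_topology T T) {z \<in> carrier G \<times> carrier G. fst z \<otimes> snd z \<in> C}"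
      using openin_continuous_map_preimage[OF continuous_mult CD(1)]
      by (simp add: topspace_eq case_prod_unfold)
    obtain A B where "openin T A" "openin T B" "C \<subseteq> A" "{\<one>} \<subseteq> B"
        and AB: "A \<times> B \<subseteq> {z \<in> carrier G \<times> carrier G. fst z \<otimes> snd z \<in> C}"
    proof (rule Wallace_theorem_prod_topology)
      show "compactin T C" by (simp add: clC closedin_compact_space compact)
      show "compactin T {\<one>}" by (simp add: topspace_eq)
      show "openin (prod_topology T T) {z \<in> carrier G \<times> carrier G. fst z \<otimes> snd z \<in> C}" by (rule op)
      show "C \<times> {\<one>} \<subseteq> {z \<in> carrier G \<times> carrier G. fst z \<otimes> snd z \<in> C}"
        using openin_subset_carrier[OF CD(1)] by auto
    qed blast
    moreover have "B \<subseteq> V"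
    proof
      fix b assume b: "b \<in> B"
      have "c \<otimes> b \<in> C \<and> b \<in> carrier G" if "c \<in> C" for c
        using subsetD[OF AB, of "(c, b)"] that b \<open>C \<subseteq> A\<close> by auto
      then show "b \<in> V" using CD(5) by (auto simp: V_def)
    qed
    ultimately show ?thesis by blast
  qed
  then obtain N where N: "openin T N" "\<one> \<in> N" "N \<subseteq> V" by blast
  \<comment> \<open>Symmetrising \<open>N\<close> makes the inverses of generators preserve
    \<open>C\<close> as well.\<close>
  define M where "M = N \<inter> {x \<in> carrier G. inv x \<in> N}"
  have M: "openin T M" "\<one> \<in> M"
    unfolding M_def using N openin_subset_carrier
    by (auto intro!: openin_Int openin_preimage continuous_intros_group)
  have Msub: "M \<subseteq> carrier G" unfolding M_def by auto
  have stab: "\<forall>c\<in>C. c \<otimes> x \<in> C" if "x \<in> generate G M" for x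
    using that
  proof induction
    case one then show ?case using openin_subset_carrier[OF CD(1)] by auto
  next
    case (incl h) then show ?case using N by (auto simp: M_def V_def)
  next
    case (inv h) then show ?case using N by (auto simp: M_def V_def)
  next
    case (eng a b)
    have "c \<otimes> (a \<otimes> b) = (c \<otimes> a) \<otimes> b" if "c \<in> C" for c
      using that openin_subset_carrier[OF CD(1)] eng(1,2) generate_in_carrier[OF Msub]
      by (subst m_assoc) auto
    then show ?case using eng by simp
  qed
  have "generate G M \<subseteq> C"
  proof
    fix x assume x: "x \<in> generate G M"
    then show "x \<in> C" using bspec[OF stab[OF x] CD(5)] generate_in_carrier[OF Msub x] by simp
  qed
  moreover have "openin T (generate G M)"
    using open_superset_subgroup[OF generate_is_subgroup[OF Msub] M(1) _ M(2)]
    by (auto intro: generate.incl)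
  ultimately obtain U where "open_normal G T U" "U \<subseteq> C"
    using open_normal_core[OF generate_is_subgroup[OF Msub]] by (metis order_trans)
  then show thesis using that CW by blast
qed

end

section \<open>Closed normal subgroups and lower central series\<close>

context group
begin

lemma subgroup_conj_preimage:
  assumes "subgroup H G" "g \<in> carrier G"
  shows "subgroup {x \<in> carrier G. g \<otimes> x \<otimes> inv g \<in> H} G"
proof (rule subgroupI)
  have "g \<otimes> \<one> \<otimes> inv g \<in> H" using assms by (simp add: subgroup.one_closed)
  then show "{x \<in> carrier G. g \<otimes> x \<otimes> inv g \<in> H} \<noteq> {}" using one_closed by blast
  fix a assume a: "a \<in> {x \<in> carrier G. g \<otimes> x \<otimes> inv g \<in> H}"
  then have "inv (g \<otimes> a \<otimes> inv g) \<in> H" using assms by (simp add: subgroup.m_inv_closed)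
  moreover have "inv (g \<otimes> a \<otimes> inv g) = g \<otimes> inv a \<otimes> inv g"
    using a assms by (simp add: inv_mult_group m_assoc)
  ultimately show "inv a \<in> {x \<in> carrier G. g \<otimes> x \<otimes> inv g \<in> H}" using a by simp
  fix b assume b: "b \<in> {x \<in> carrier G. g \<otimes> x \<otimes> inv g \<in> H}"
  then have "(g \<otimes> a \<otimes> inv g) \<otimes> (g \<otimes> b \<otimes> inv g) \<in> H"
    using a assms by (simp add: subgroup.m_closed)
  moreover have "(g \<otimes> a \<otimes> inv g) \<otimes> (g \<otimes> b \<otimes> inv g) = g \<otimes> (a \<otimes> b) \<otimes> inv g"
    using a b assms by (simp add: m_assoc)
  ultimately show "a \<otimes> b \<in> {x \<in> carrier G. g \<otimes> x \<otimes> inv g \<in> H}" using a b by simp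
qed auto

text \<open>Closure under products comes from \<open>commutator_mult_left\<close>, whose conjugated
  factor stays in \<open>P\<close> because \<open>D\<close> normalises \<open>P\<close>. This
  reduces commutator conditions on a generated subgroup to its generators.\<close>

lemma subgroup_commutator_left_preimage:
  assumes "subgroup D G" "subgroup P G" "e \<in> carrier G"
    and "\<And>x p. \<lbrakk>x \<in> D; p \<in> P\<rbrakk> \<Longrightarrow> x \<otimes> p \<otimes> inv x \<in> P"
  shows "subgroup {x \<in> D. cmt x e \<in> P} G"
proof (rule subgroupI)
  have D: "D \<subseteq> carrier G" by (rule subgroup.subset[OF assms(1)])
  then show "{x \<in> D. cmt x e \<in> P} \<subseteq> carrier G" by blast
  show "{x \<in> D. cmt x e \<in> P} \<noteq> {}"
    using assms(1-3) subgroup.one_closed by (force intro!: exI[of _ \<one>])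
  fix a assume a: "a \<in> {x \<in> D. cmt x e \<in> P}"
  then have ac: "a \<in> carrier G" using D by blast
  have "inv a \<in> D" using a assms(1) by (simp add: subgroup.m_inv_closed)
  moreover have "cmt e a \<in> P"
    using a ac assms(2,3) subgroup.m_inv_closed inv_commutator by fastforce
  ultimately show "inv a \<in> {x \<in> D. cmt x e \<in> P}"
    using assms(4)[of "inv a" "cmt e a"] ac assms(3) by (simp add: commutator_inv_left)
  fix b assume b: "b \<in> {x \<in> D. cmt x e \<in> P}"
  then have bc: "b \<in> carrier G" using D by blast
  show "a \<otimes> b \<in> {x \<in> D. cmt x e \<in> P}"
    using a b ac bc assms(1-3) assms(4)[of a "cmt b e"]
    by (simp add: commutator_mult_left subgroup.m_closed)
qed

lemma subgroup_commutator_right_preimage: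
  assumes "subgroup D G" "subgroup P G" "e \<in> carrier G"
    and "\<And>x p. \<lbrakk>x \<in> D; p \<in> P\<rbrakk> \<Longrightarrow> x \<otimes> p \<otimes> inv x \<in> P"
  shows "subgroup {x \<in> D. cmt e x \<in> P} G"
proof -
  have "cmt e x \<in> P \<longleftrightarrow> cmt x e \<in> P" if "x \<in> D" for x
    using subgroup.m_inv_closed[OF assms(2)] inv_commutator assms(3) subgroup.subset[OF assms(1)] that
    by (metis subsetD)
  then have "{x \<in> D. cmt e x \<in> P} = {x \<in> D. cmt x e \<in> P}" by blast
  then show ?thesis using subgroup_commutator_left_preimage[OF assms] by simp
qed

end

section \<open>Closed and open normal subgroups\<close>

context profinite_group
begin

lemma closed_normalD:
  assumes "closed_normal G T N"
  shows "N \<lhd> G" "closedin T N" "subgroup N G" "N \<subseteq> carrier G" "\<one> \<in> N"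
  using assms normal_imp_subgroup[of N] normal_subset[of N] subgroup.one_closed[of N G]
  by (auto simp: closed_normal_def)

lemma open_normal_imp_closed_normal: "open_normal G T N \<Longrightarrow> closed_normal G T N"
  by (simp add: closed_normal_def open_normal_def open_subgroup_closed normal_imp_subgroup)

lemma open_normalD:
  assumes "open_normal G T N"
  shows "N \<lhd> G" "openin T N" "closedin T N" "subgroup N G" "N \<subseteq> carrier G" "\<one> \<in> N"
  using assms closed_normalD[OF open_normal_imp_closed_normal[OF assms]]
  by (auto simp: open_normal_def)

lemma closed_normal_carrier: "closed_normal G T (carrier G)"
  using closedin_topspace[of T] normal_invI[OF subgroup_self]
  by (simp add: closed_normal_def topspace_eq)

lemma open_normal_carrier: "open_normal G T (carrier G)"
  using openin_topspace[of T] normal_invI[OF subgroup_self]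
  by (simp add: open_normal_def topspace_eq)

lemma closed_normal_Int:
  "\<lbrakk>closed_normal G T A; closed_normal G T B\<rbrakk> \<Longrightarrow> closed_normal G T (A \<inter> B)"
  by (simp add: closed_normal_def normal_subgroup_intersect closedin_Int)

lemma open_normal_Int:
  "\<lbrakk>open_normal G T A; open_normal G T B\<rbrakk> \<Longrightarrow> open_normal G T (A \<inter> B)"
  by (simp add: open_normal_def normal_subgroup_intersect openin_Int)

lemma closed_normal_Inter:
  "\<lbrakk>\<A> \<noteq> {}; \<And>N. N \<in> \<A> \<Longrightarrow> closed_normal G T N\<rbrakk> \<Longrightarrow> closed_normal G T (\<Inter>\<A>)"
  by (simp add: closed_normal_def normal_Inter closedin_Inter)

lemma closed_normal_set_mult:
  "\<lbrakk>closed_normal G T A; closed_normal G T B\<rbrakk> \<Longrightarrow> closed_normal G T (A <#> B)"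
  by (simp add: closed_normal_def normal_subgroup_set_mult_closed closedin_set_mult)

lemma open_normal_mono:
  assumes "open_normal G T U" "closed_normal G T N" "U \<subseteq> N"
  shows "open_normal G T N"
  using assms open_superset_subgroup[of N U] closed_normalD[OF assms(2)] open_normalD[OF assms(1)]
  by (simp add: open_normal_def)

lemma open_normal_set_mult:
  assumes "closed_normal G T A" "open_normal G T B"
  shows "open_normal G T (A <#> B)"
  using closed_normal_set_mult[OF assms(1) open_normal_imp_closed_normal[OF assms(2)]]
    subset_set_mult_right[of B A] closed_normalD[OF assms(1)] open_normalD[OF assms(2)] open_normal_mono[OF assms(2)]
  by blast

text \<open>The elements \<open>u\<close> with \<open>x \<otimes> inv u\<close> outside
  \<open>A\<close> form an open neighbourhood of \<open>\<one>\<close>, which contains some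
  \<open>U\<close>. Closed sets are therefore intersections of sets \<open>A <#> U\<close>.\<close>

lemma separate_by_open_normal:
  assumes "closedin T A" "x \<in> carrier G" "x \<notin> A"
  obtains U where "open_normal G T U" "x \<notin> A <#> U"
proof -
  let ?W = "{u \<in> carrier G. x \<otimes> inv u \<in> carrier G - A}"
  have "openin T (carrier G - A)"
    using assms(1) topspace_eq by (metis closedin_def)
  then have "openin T ?W"
    using assms(2) by (intro openin_preimage continuous_intros_group)
  moreover have "\<one> \<in> ?W" using assms by simp
  ultimately obtain U where U: "open_normal G T U" "U \<subseteq> ?W"
    using open_normal_basis by blast
  have "x \<notin> A <#> U"
  proof
    assume "x \<in> A <#> U"
    then obtain a u where "a \<in> A" "u \<in> U" "x = a \<otimes> u" by (rule set_multE)
    moreover have "a \<in> carrier G" using \<open>a \<in> A\<close> assms(1) closedin_subset_carrier by blast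
    ultimately show False using U(2) by (auto simp: m_assoc subset_iff)
  qed
  then show thesis using U that by blast
qed

section \<open>Topologically generated subgroups and closed commutator subgroups\<close>

lemma subgroup_closure_of:
  assumes "subgroup H G"
  shows "subgroup (T closure_of H) G"
proof (rule subgroupI)
  have H: "H \<subseteq> carrier G" by (rule subgroup.subset[OF assms])
  then have sub: "H \<subseteq> T closure_of H" by (simp add: closure_of_subset topspace_eq)
  show "T closure_of H \<subseteq> carrier G" using closure_of_subset_topspace topspace_eq by metis
  show "T closure_of H \<noteq> {}" using sub subgroup.one_closed[OF assms] by blast
  have "(\<lambda>x. inv x) ` (T closure_of H) \<subseteq> T closure_of ((\<lambda>x. inv x) ` H)"
    using continuous_inv by (rule continuous_map_image_closure_subset)
  also have "\<dots> \<subseteq> T closure_of H"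
    using assms by (intro closure_of_mono) (auto simp: subgroup.m_inv_closed)
  finally show "inv a \<in> T closure_of H" if "a \<in> T closure_of H" for a using that by blast
  have "(\<lambda>(x, y). x \<otimes> y) ` (prod_topology T T closure_of (H \<times> H))
      \<subseteq> T closure_of ((\<lambda>(x, y). x \<otimes> y) ` (H \<times> H))"
    using continuous_mult by (rule continuous_map_image_closure_subset)
  also have "\<dots> \<subseteq> T closure_of H"
    using assms by (intro closure_of_mono) (auto simp: subgroup.m_closed)
  finally show "a \<otimes> b \<in> T closure_of H" if "a \<in> T closure_of H" "b \<in> T closure_of H" for a b
    using that by (auto simp: closure_of_Times)
qed

lemma subgroup_closed_generate:
  "A \<subseteq> carrier G \<Longrightarrow> subgroup (closed_generate G T A) G"
  by (simp add: closed_generate_def subgroup_closure_of generate_is_subgroup)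

lemma closedin_closed_generate: "closedin T (closed_generate G T A)"
  by (simp add: closed_generate_def)

lemma closed_generate_superset:
  assumes "A \<subseteq> carrier G"
  shows "A \<subseteq> closed_generate G T A"
proof -
  have "A \<subseteq> generate G A" by (auto intro: generate.incl)
  also have "\<dots> \<subseteq> closed_generate G T A"
    using generate_incl[OF assms] by (simp add: closed_generate_def closure_of_subset topspace_eq)
  finally show ?thesis .
qed

lemma closed_generate_minimal:
  assumes "A \<subseteq> H" "subgroup H G" "closedin T H"
  shows "closed_generate G T A \<subseteq> H"
  unfolding closed_generate_def
  using generate_subgroup_incl[OF assms(1,2)] assms(3) by (rule closure_of_minimal)

lemma closed_generate_mono: "A \<subseteq> B \<Longrightarrow> closed_generate G T A \<subseteq> closed_generate G T B"
  by (simp add: closed_generate_def closure_of_mono mono_generate)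

text \<open>The elements that conjugation by \<open>g\<close> sends into the closed subgroup
  generated by \<open>A\<close> form a closed subgroup themselves, so it suffices to conjugate the
  generators.\<close>

lemma closed_generate_conj:
  assumes "A \<subseteq> carrier G" "g \<in> carrier G"
    and "\<And>x. x \<in> A \<Longrightarrow> g \<otimes> x \<otimes> inv g \<in> closed_generate G T A"
    and "x \<in> closed_generate G T A"
  shows "g \<otimes> x \<otimes> inv g \<in> closed_generate G T A"
proof -
  have "closed_generate G T A \<subseteq> {x \<in> carrier G. g \<otimes> x \<otimes> inv g \<in> closed_generate G T A}"
  proof (rule closed_generate_minimal)
    show "closedin T {x \<in> carrier G. g \<otimes> x \<otimes> inv g \<in> closed_generate G T A}"
      using assms(2) by (intro closedin_preimage continuous_intros_group closedin_closed_generate) auto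
  qed (use assms in \<open>auto intro!: subgroup_conj_preimage subgroup_closed_generate\<close>)
  then show ?thesis using assms(4) by blast
qed

lemma commutators_subset_carrier:
  "\<lbrakk>A \<subseteq> carrier G; B \<subseteq> carrier G\<rbrakk> \<Longrightarrow> {cmt x y |x y. x \<in> A \<and> y \<in> B} \<subseteq> carrier G"
  using commutator_closed by blast

lemma commutator_in_closed_commutator:
  assumes "A \<subseteq> carrier G" "B \<subseteq> carrier G" "x \<in> A" "y \<in> B"
  shows "cmt x y \<in> closed_commutator G T A B"
  using closed_generate_superset[OF commutators_subset_carrier[OF assms(1,2)]] assms(3,4)
  unfolding closed_commutator_eq by blast

lemma closed_commutator_minimal:
  assumes "\<And>x y. \<lbrakk>x \<in> A; y \<in> B\<rbrakk> \<Longrightarrow> cmt x y \<in> H" "subgroup H G" "closedin T H"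
  shows "closed_commutator G T A B \<subseteq> H"
  unfolding closed_commutator_eq using assms by (intro closed_generate_minimal) auto

lemma closed_commutator_mono:
  "\<lbrakk>A \<subseteq> A'; B \<subseteq> B'\<rbrakk> \<Longrightarrow> closed_commutator G T A B \<subseteq> closed_commutator G T A' B'"
  unfolding closed_commutator_eq by (rule closed_generate_mono) blast

lemma closed_normal_closed_commutator:
  assumes "closed_normal G T A" "closed_normal G T B"
  shows "closed_normal G T (closed_commutator G T A B)"
proof -
  let ?S = "{cmt x y |x y. x \<in> A \<and> y \<in> B}"
  have sub: "A \<subseteq> carrier G" "B \<subseteq> carrier G"
    using assms by (auto dest: closed_normalD(4))
  note S = commutators_subset_carrier[OF this]
  have "closed_generate G T ?S \<lhd> G"
  proof (rule normal_invI)
    fix g x assume g: "g \<in> carrier G" and x: "x \<in> closed_generate G T ?S"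
    have "g \<otimes> z \<otimes> inv g \<in> ?S" if "z \<in> ?S" for z
    proof -
      from that obtain a b where ab: "a \<in> A" "b \<in> B" "z = cmt a b" by blast
      then have "g \<otimes> z \<otimes> inv g = cmt (g \<otimes> a \<otimes> inv g) (g \<otimes> b \<otimes> inv g)"
        using sub g by (auto intro: commutator_conj)
      moreover have "g \<otimes> a \<otimes> inv g \<in> A" "g \<otimes> b \<otimes> inv g \<in> B"
        using ab g assms by (auto intro: normal_conj closed_normalD(1))
      ultimately show ?thesis by blast
    qed
    then show "g \<otimes> x \<otimes> inv g \<in> closed_generate G T ?S"
      using closed_generate_superset[OF S] by (intro closed_generate_conj[OF S g _ x]) blast
  qed (rule subgroup_closed_generate[OF S])
  then show ?thesis
    by (simp add: closed_normal_def closed_commutator_eq closedin_closed_generate)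
qed

lemma closed_commutator_subset_left:
  assumes "closed_normal G T A" "B \<subseteq> carrier G"
  shows "closed_commutator G T A B \<subseteq> A"
  using assms closed_normalD[OF assms(1)]
  by (intro closed_commutator_minimal) (auto intro: commutator_in_normal_left)

lemma closed_commutator_subset_right:
  assumes "A \<subseteq> carrier G" "closed_normal G T B"
  shows "closed_commutator G T A B \<subseteq> B"
  using assms closed_normalD[OF assms(2)]
  by (intro closed_commutator_minimal) (auto intro: commutator_in_normal_right)

section \<open>The lower central series\<close>

abbreviation lcs :: "nat \<Rightarrow> 'a set \<Rightarrow> 'a set" where
  "lcs i K \<equiv> lower_central G T i K"

text \<open>Index \<open>0\<close> is excluded: with its dummy value \<open>K\<close> the recursion
  would produce \<open>[K, K]\<close> where \<open>lcs 1 K\<close> is \<open>K\<close>. Inductions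
  below therefore treat \<open>i = 0\<close> apart.\<close>

lemma lcs_Suc: "0 < i \<Longrightarrow> lcs (Suc i) K = closed_commutator G T (lcs i K) K"
  by (cases i) auto

lemma lcs_mono: "A \<subseteq> B \<Longrightarrow> lcs i A \<subseteq> lcs i B"
proof (induction i)
  case (Suc i)
  then show ?case by (cases "i = 0") (simp_all add: lcs_Suc closed_commutator_mono)
qed simp

lemma closed_normal_lcs: "closed_normal G T K \<Longrightarrow> closed_normal G T (lcs i K)"
proof (induction i)
  case (Suc i)
  then show ?case by (cases "i = 0") (auto simp: lcs_Suc intro: closed_normal_closed_commutator)
qed simp

lemma lcs_subset: "closed_normal G T K \<Longrightarrow> lcs i K \<subseteq> K"
proof (induction i)
  case (Suc i)
  then show ?case
    using closed_commutator_subset_right[of "lcs i K" K] closed_normalD(4)[OF closed_normal_lcs]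
    by (cases "i = 0") (auto simp: lcs_Suc)
qed simp

lemma commutator_in_lcs:
  assumes "closed_normal G T K" "0 < i" "x \<in> lcs i K" "y \<in> K"
  shows "cmt x y \<in> lcs (Suc i) K"
  using assms closed_normalD(4)[OF closed_normal_lcs[OF assms(1)]] closed_normalD(4)[OF assms(1)]
  by (auto simp: lcs_Suc intro: commutator_in_closed_commutator)

lemma lcs_Suc_subset: "closed_normal G T K \<Longrightarrow> lcs (Suc i) K \<subseteq> lcs i K"
  using closed_commutator_subset_left[of "lcs i K" K] closed_normalD(4)[of K] closed_normal_lcs[of K i]
  by (cases "i = 0") (auto simp: lcs_Suc)

lemma lcs_antimono: "\<lbrakk>closed_normal G T K; i \<le> j\<rbrakk> \<Longrightarrow> lcs j K \<subseteq> lcs i K"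
  by (rule lift_Suc_antimono_le[of "\<lambda>i. lcs i K"]) (rule lcs_Suc_subset)

text \<open>A non-trivial term is a closed normal subgroup, hence non-abelian, and a non-trivial
  commutator of two of its elements lies in the next term.\<close>

lemma lcs_nontrivial:
  assumes no_abelian:
      "\<not> (\<exists>N. closed_normal G T N \<and> (\<forall>x\<in>N. \<forall>y\<in>N. x \<otimes> y = y \<otimes> x) \<and> N \<noteq> {\<one>})"
    and K: "closed_normal G T K" "K \<noteq> {\<one>}"
  shows "lcs i K \<noteq> {\<one>}"
proof (induction i)
  case (Suc i)
  show ?case
  proof (cases "i = 0")
    case False
    note L = closed_normal_lcs[OF K(1), of i]
    obtain x y where xy: "x \<in> lcs i K" "y \<in> lcs i K" "x \<otimes> y \<noteq> y \<otimes> x"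
      using no_abelian L Suc by blast
    then have "x \<in> carrier G" "y \<in> carrier G" "y \<in> K"
      using closed_normalD(4)[OF L] lcs_subset[OF K(1)] by auto
    then have "cmt x y \<in> lcs (Suc i) K" "cmt x y \<noteq> \<one>"
      using xy False K(1) by (auto simp: commutator_eq_one_iff intro!: commutator_in_lcs)
    then show ?thesis by blast
  qed (use K in simp)
qed (use K in simp)

end

section \<open>Commutators in products of normal subgroups\<close>

context profinite_group
begin

text \<open>For normal \<open>Y\<close> and \<open>E = carrier G\<close> these are the preimages of
  the upper central series of \<open>G / Y\<close>. In general, level \<open>n\<close> consists of
  those \<open>x\<close> for which all left-normed commutators \<open>[x, e1, ..., en]\<close> with
  entries from \<open>E\<close> lie in \<open>Y\<close>.\<close>

fun relative_hypercenter :: "'a set \<Rightarrow> 'a set \<Rightarrow> nat \<Rightarrow> 'a set" where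
  "relative_hypercenter E Y 0 = Y"
| "relative_hypercenter E Y (Suc n) = {x \<in> carrier G. \<forall>e\<in>E. cmt x e \<in> relative_hypercenter E Y n}"

text \<open>Each level is an intersection, over \<open>e \<in> E\<close>, of preimages of the
  previous level. Conjugating \<open>x\<close> amounts to conjugating \<open>e\<close> the opposite
  way, and the result stays in the normal subgroup \<open>E\<close>.\<close>

lemma closed_normal_relative_hypercenter:
  assumes "closed_normal G T E" "closed_normal G T Y"
  shows "closed_normal G T (relative_hypercenter E Y n)"
proof (induction n)
  case (Suc n)
  let ?Z = "relative_hypercenter E Y n"
  note Z = closed_normalD[OF Suc] and E = closed_normalD[OF assms(1)]
  have Ec: "e \<in> carrier G" if "e \<in> E" for e using E(4) that by blast
  let ?P = "\<lambda>e. {x \<in> carrier G. cmt x e \<in> ?Z}"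
  have eq: "relative_hypercenter E Y (Suc n) = (\<Inter>e\<in>E. ?P e)"
    using E(5) by auto
  have sub: "subgroup (?P e) G" if "e \<in> E" for e
    using normal_conj[OF Z(1)] by (intro subgroup_commutator_left_preimage subgroup_self Z Ec that) auto
  have clo: "closedin T (?P e)" if "e \<in> E" for e
    by (intro closedin_preimage continuous_intros_group Z Ec that)
  have "relative_hypercenter E Y (Suc n) \<lhd> G"
  proof (rule normal_invI)
    show "subgroup (relative_hypercenter E Y (Suc n)) G"
      unfolding eq using sub E(5) by (intro subgroups_Inter) auto
    fix g x assume g: "g \<in> carrier G" and x: "x \<in> relative_hypercenter E Y (Suc n)"
    have "cmt (g \<otimes> x \<otimes> inv g) e \<in> ?Z" if e: "e \<in> E" for e
    proof -
      have "cmt x (inv g \<otimes> e \<otimes> g) \<in> ?Z"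
        using x normal_conj_inv[OF E(1) g e] by simp
      then have "g \<otimes> cmt x (inv g \<otimes> e \<otimes> g) \<otimes> inv g \<in> ?Z"
        by (rule normal_conj[OF Z(1) g])
      moreover have "g \<otimes> cmt x (inv g \<otimes> e \<otimes> g) \<otimes> inv g = cmt (g \<otimes> x \<otimes> inv g) e"
        using x g Ec[OF e] by (subst commutator_conj) (auto simp: m_assoc)
      ultimately show ?thesis by simp
    qed
    then show "g \<otimes> x \<otimes> inv g \<in> relative_hypercenter E Y (Suc n)" using x g by simp
  qed
  moreover have "closedin T (relative_hypercenter E Y (Suc n))"
    unfolding eq using clo E(5) by (intro closedin_INT) auto
  ultimately show ?case by (simp add: closed_normal_def)
qed (use assms in simp)

text \<open>Every commutation with \<open>E\<close> lowers the level by one, so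
  \<open>lcs (Suc i) E\<close> sits at level \<open>n - i\<close>.\<close>

lemma lcs_subset_if_subset_hypercenter:
  assumes "closed_normal G T E" "closed_normal G T Y" "E \<subseteq> relative_hypercenter E Y n"
  shows "lcs (Suc n) E \<subseteq> Y"
proof -
  have "lcs (Suc i) E \<subseteq> relative_hypercenter E Y (n - i)" if "i \<le> n" for i
    using that
  proof (induction i)
    case (Suc i)
    then have "n - i = Suc (n - Suc i)" by simp
    then have "lcs (Suc i) E \<subseteq> relative_hypercenter E Y (Suc (n - Suc i))"
      using Suc by simp
    then have "closed_commutator G T (lcs (Suc i) E) E \<subseteq> relative_hypercenter E Y (n - Suc i)"
      using closed_normalD[OF closed_normal_relative_hypercenter[OF assms(1,2)]]
      by (intro closed_commutator_minimal) auto
    then show ?case by (simp add: lcs_Suc)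
  qed (use assms in simp)
  from this[of n] show ?thesis by simp
qed

text \<open>
  Fitting's theorem: a commutator whose entries lie in \<open>K\<close> or \<open>V\<close> and that has \<open>2 c + 1\<close> of them
  contains more than \<open>c\<close> entries from one of the two.
\<close>

lemma lcs_set_mult_subset:
  assumes K: "closed_normal G T K" and V: "closed_normal G T V" and Y: "closed_normal G T Y"
    and KY: "lcs (Suc c) K \<subseteq> Y" and VY: "lcs (Suc c) V \<subseteq> Y"
  shows "lcs (Suc (2 * c)) (K <#> V) \<subseteq> Y"
proof -
  define E where "E = K <#> V"
  have E: "closed_normal G T E" unfolding E_def by (rule closed_normal_set_mult[OF K V])
  \<comment> \<open>Differs from \<open>lcs\<close> at index \<open>0\<close>: there no commutator
    entry is demanded, so the value has to be the whole group instead of the dummy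
    \<open>A\<close>.\<close>
  define lc where "lc = (\<lambda>a A. if a = 0 then carrier G else lcs a A)"
  have lc: "closed_normal G T (lc a A)" if "closed_normal G T A" for a A
    using that by (simp add: lc_def closed_normal_lcs closed_normal_carrier)
  have lc_Suc: "cmt x y \<in> lc (Suc a) A"
    if "closed_normal G T A" "x \<in> lc a A" "y \<in> A" for a A x y
    using that commutator_in_normal_right[OF closed_normalD(1)[OF that(1)]] closed_normalD(4)[OF that(1)]
    by (cases "a = 0") (auto simp: lc_def intro: commutator_in_lcs)
  let ?Z = "relative_hypercenter E Y"
  note Z = closed_normalD[OF closed_normal_relative_hypercenter[OF E Y]]
  \<comment> \<open>\<open>a\<close> and \<open>b\<close> count the entries from \<open>K\<close>
    and \<open>V\<close> so far, \<open>n\<close> the entries still to come. An entry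
    \<open>k \<otimes> v\<close> splits by \<open>commutator_mult_right\<close> into one that raises
    \<open>a\<close> and one that raises \<open>b\<close>; for \<open>n = 0\<close> one of the two
    counts exceeds \<open>c\<close>.\<close>
  have main: "lc a K \<inter> lc b V \<subseteq> ?Z n" if "2 * c + 1 \<le> a + b + n" for a b n
    using that
  proof (induction n arbitrary: a b)
    case 0
    then consider "Suc c \<le> a" | "Suc c \<le> b" by linarith
    then show ?case
      using lcs_antimono[OF K, of "Suc c" a] lcs_antimono[OF V, of "Suc c" b] KY VY
      by cases (auto simp: lc_def)
  next
    case (Suc n)
    show ?case
    proof
      fix x assume x: "x \<in> lc a K \<inter> lc b V"
      have xc: "x \<in> carrier G" using x closed_normalD(4)[OF lc[OF K]] by blast
      have "cmt x e \<in> ?Z n" if "e \<in> E" for e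
      proof -
        from that obtain k v where kv: "k \<in> K" "v \<in> V" "e = k \<otimes> v"
          unfolding E_def by (rule set_multE)
        have kvc: "k \<in> carrier G" "v \<in> carrier G"
          using kv closed_normalD(4) K V by blast+
        have "cmt x k \<in> lc (Suc a) K \<inter> lc b V"
          using x kv kvc lc_Suc[OF K] commutator_in_normal_left[OF closed_normalD(1)[OF lc[OF V]]] by blast
        then have 1: "cmt x k \<in> ?Z n" using Suc.IH[of "Suc a" b] Suc.prems by auto
        have "cmt x v \<in> lc a K \<inter> lc (Suc b) V"
          using x kv kvc lc_Suc[OF V] commutator_in_normal_left[OF closed_normalD(1)[OF lc[OF K]]] by blast
        then have "cmt x v \<in> ?Z n" using Suc.IH[of a "Suc b"] Suc.prems by auto
        then have 2: "k \<otimes> cmt x v \<otimes> inv k \<in> ?Z n" using normal_conj[OF Z(1)] kvc by blast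
        have "cmt x e = cmt x k \<otimes> (k \<otimes> cmt x v \<otimes> inv k)"
          using kv kvc xc by (simp add: commutator_mult_right)
        then show ?thesis using 1 2 Z(3) by (simp add: subgroup.m_closed)
      qed
      then show "x \<in> ?Z (Suc n)" using xc by simp
    qed
  qed
  have "K \<subseteq> ?Z (2 * c)" "V \<subseteq> ?Z (2 * c)"
    using main[of 1 0 "2 * c"] main[of 0 1 "2 * c"] closed_normalD(4)[OF K] closed_normalD(4)[OF V]
    by (auto simp: lc_def)
  then have "K <#> V \<subseteq> ?Z (2 * c)"
    using Z(3) by (rule set_mult_subset_subgroup)
  then have "E \<subseteq> ?Z (2 * c)" by (simp only: E_def)
  then show ?thesis
    using lcs_subset_if_subset_hypercenter[OF E Y] by (simp add: E_def)
qed

end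

section \<open>Multilinearity of commutators and subsets of finite index\<close>

context group
begin

text \<open>Level \<open>n\<close> holds the left-normed commutators with \<open>n + 1\<close>
  entries; the shift matches \<open>lcs (Suc n)\<close>.\<close>

fun iterated_commutators :: "'a set \<Rightarrow> nat \<Rightarrow> 'a set" where
  "iterated_commutators A 0 = A"
| "iterated_commutators A (Suc n) = (\<lambda>(x, a). cmt x a) ` (iterated_commutators A n \<times> A)"

lemma finite_iterated_commutators: "finite A \<Longrightarrow> finite (iterated_commutators A n)"
  by (induction n) auto

lemma coset_mult_normal_left:
  assumes "N \<lhd> G" "n \<in> N" "x \<in> carrier G"
  shows "N #> (n \<otimes> x) = N #> x"
proof -
  have "n \<otimes> x \<in> N #> x" using assms by (auto simp: r_coset_def)
  then show ?thesis
    using repr_independence[of "n \<otimes> x" N x] assms normal_imp_subgroup by blast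
qed

lemma coset_pow_cong:
  assumes "N \<lhd> G" "x \<in> carrier G" "y \<in> carrier G" "N #> x = N #> y"
  shows "N #> (x [^] (k::nat)) = N #> (y [^] k)"
proof (induction k)
  case (Suc k)
  then show ?case
    using assms by (simp flip: normal.rcos_sum[OF assms(1)])
qed simp

text \<open>Splitting off one factor \<open>x\<close> leaves the error term
  \<open>cmt x (cmt (x [^] k) e)\<close>, which lies in \<open>N\<close>; modulo \<open>N\<close>
  the commutator is thus multiplicative along the powers of \<open>x\<close>.\<close>

lemma coset_commutator_pow_left:
  assumes N: "N \<lhd> G" and x: "x \<in> carrier G" and e: "e \<in> carrier G"
    and *: "\<And>k::nat. cmt x (cmt (x [^] k) e) \<in> N"
  shows "N #> cmt (x [^] (k::nat)) e = N #> (cmt x e [^] k)"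
proof (induction k)
  case (Suc k)
  have "cmt (x [^] Suc k) e = (cmt x (cmt (x [^] k) e) \<otimes> cmt (x [^] k) e) \<otimes> cmt x e"
    unfolding nat_pow_Suc2[OF x] using x e
    by (simp add: commutator_mult_left conj_eq_commutator_mult)
  also have "\<dots> = cmt x (cmt (x [^] k) e) \<otimes> (cmt (x [^] k) e \<otimes> cmt x e)"
    using x e by (simp add: m_assoc)
  finally have "cmt (x [^] Suc k) e = cmt x (cmt (x [^] k) e) \<otimes> (cmt (x [^] k) e \<otimes> cmt x e)" .
  then have "N #> cmt (x [^] Suc k) e = N #> (cmt (x [^] k) e \<otimes> cmt x e)"
    using coset_mult_normal_left[OF N *] x e by simp
  then show ?case
    using Suc x e by (simp flip: normal.rcos_sum[OF N])
qed (use e in simp)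

text \<open>Here the error term of each step is \<open>cmt (e [^] k) (cmt x e)\<close>.\<close>

lemma coset_commutator_pow_right:
  assumes N: "N \<lhd> G" and x: "x \<in> carrier G" and e: "e \<in> carrier G"
    and *: "\<And>k::nat. cmt (e [^] k) (cmt x e) \<in> N"
  shows "N #> cmt x (e [^] (k::nat)) = N #> (cmt x e [^] k)"
proof (induction k)
  case (Suc k)
  have "cmt x (e [^] Suc k) = cmt x (e [^] k) \<otimes> (cmt (e [^] k) (cmt x e) \<otimes> cmt x e)"
    using x e by (simp add: commutator_mult_right conj_eq_commutator_mult)
  then have "N #> cmt x (e [^] Suc k) = (N #> cmt x (e [^] k)) <#> (N #> cmt x e)"
    using coset_mult_normal_left[OF N *] x e by (simp flip: normal.rcos_sum[OF N])
  then show ?case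
    using Suc x e by (simp flip: normal.rcos_sum[OF N])
qed (use x in simp)

text \<open>For a fixed second entry the admissible first entries form a subgroup, and likewise with
  the roles exchanged; so it is enough to test entries from \<open>A \<union> B\<close>.\<close>

lemma commutators_set_mult:
  assumes W: "W \<lhd> G" and sub: "A \<subseteq> carrier G" "B \<subseteq> carrier G"
    and *: "\<And>x y. \<lbrakk>x \<in> A \<union> B; y \<in> A \<union> B\<rbrakk> \<Longrightarrow> cmt x y \<in> W"
    and xy: "x \<in> A <#> B" "y \<in> A <#> B"
  shows "cmt x y \<in> W"
proof -
  have conj: "z \<otimes> w \<otimes> inv z \<in> W" if "z \<in> carrier G" "w \<in> W" for z w
    using that normal_conj[OF W] by blast
  have xc: "x \<in> carrier G" using xy(1) sub by (auto simp: set_mult_def)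
  have 1: "cmt x y \<in> W" if "y \<in> A \<union> B" for y
  proof -
    have "A <#> B \<subseteq> {x \<in> carrier G. cmt x y \<in> W}"
      using that sub * by (intro set_mult_subset_subgroup
          subgroup_commutator_left_preimage[OF subgroup_self normal_imp_subgroup[OF W] _ conj]) auto
    then show ?thesis using xy by blast
  qed
  have "A <#> B \<subseteq> {y \<in> carrier G. cmt x y \<in> W}"
    using 1 sub by (intro set_mult_subset_subgroup
        subgroup_commutator_right_preimage[OF subgroup_self normal_imp_subgroup[OF W] xc conj]) auto
  then show ?thesis using xy by blast
qed

text \<open>Finite index expressed as a cover by finitely many left translates; in this form
  transitivity amounts to multiplying the sets of representatives.\<close>

definition finite_index_in :: "'a set \<Rightarrow> 'a set \<Rightarrow> bool" where
  "finite_index_in W D \<longleftrightarrow> (\<exists>F. finite F \<and> F \<subseteq> carrier G \<and> D \<subseteq> F <#> W)"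

lemma finite_set_mult: "\<lbrakk>finite A; finite B\<rbrakk> \<Longrightarrow> finite (A <#> B)"
  by (simp add: set_mult_def)

lemma finite_index_in_trans:
  assumes "finite_index_in C B" "finite_index_in B A" "C \<subseteq> carrier G"
  shows "finite_index_in C A"
proof -
  obtain F F' where F: "finite F" "F \<subseteq> carrier G" "A \<subseteq> F <#> B"
      and F': "finite F'" "F' \<subseteq> carrier G" "B \<subseteq> F' <#> C"
    using assms unfolding finite_index_in_def by blast
  have "F <#> B \<subseteq> F <#> (F' <#> C)" using F'(3) by (intro mono_set_mult) auto
  with F(3) have "A \<subseteq> F <#> (F' <#> C)" by (rule order_trans)
  also have "\<dots> = (F <#> F') <#> C" using F F' assms(3) by (simp add: set_mult_assoc)
  finally show ?thesis
    unfolding finite_index_in_def using F F' finite_set_mult setmult_subset_G by metis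
qed

lemma finite_index_in_refl:
  assumes "W \<subseteq> carrier G"
  shows "finite_index_in W W"
proof -
  have "W \<subseteq> {\<one>} <#> W" using assms by (force simp: set_mult_def)
  then show ?thesis unfolding finite_index_in_def by blast
qed

text \<open>An intermediate subgroup \<open>Y\<close> equals \<open>(F \<inter> Y) <#> W\<close> and
  is thus determined by a subset of the finite set \<open>F\<close>.\<close>

lemma finite_intermediate_subgroups:
  assumes "finite_index_in W D" "W \<subseteq> carrier G"
  shows "finite {Y. subgroup Y G \<and> W \<subseteq> Y \<and> Y \<subseteq> D}"
proof -
  obtain F where F: "finite F" "F \<subseteq> carrier G" "D \<subseteq> F <#> W"
    using assms unfolding finite_index_in_def by blast
  have "Y = (F \<inter> Y) <#> W" if Y: "subgroup Y G" "W \<subseteq> Y" "Y \<subseteq> D" for Y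
  proof
    show "(F \<inter> Y) <#> W \<subseteq> Y" using Y by (intro set_mult_subset_subgroup) auto
    show "Y \<subseteq> (F \<inter> Y) <#> W"
    proof
      fix y assume y: "y \<in> Y"
      then obtain f w where fw: "f \<in> F" "w \<in> W" "y = f \<otimes> w"
        using F Y by (blast elim: set_multE)
      then have "f = y \<otimes> inv w" using F assms(2) by (auto simp: m_assoc subset_iff)
      moreover have "inv w \<in> Y" using fw Y by (blast intro: subgroup.m_inv_closed)
      ultimately have "f \<in> Y" using y subgroup.m_closed[OF Y(1)] by simp
      then show "y \<in> (F \<inter> Y) <#> W" using fw by (auto intro: set_multI)
    qed
  qed
  then have "{Y. subgroup Y G \<and> W \<subseteq> Y \<and> Y \<subseteq> D} \<subseteq> (\<lambda>F. F <#> W) ` Pow F" by blast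
  then show ?thesis using F(1) finite_subset by blast
qed

lemma finite_factor_group:
  assumes "N \<lhd> G" "finite_index_in N (carrier G)"
  shows "finite (carrier (G Mod N))"
proof -
  obtain F where F: "finite F" "F \<subseteq> carrier G" "carrier G \<subseteq> F <#> N"
    using assms unfolding finite_index_in_def by blast
  have "carrier (G Mod N) \<subseteq> (\<lambda>f. N #> f) ` F"
  proof
    fix C assume "C \<in> carrier (G Mod N)"
    then obtain x where x: "x \<in> carrier G" "C = N #> x"
      by (auto simp: FactGroup_def RCOSETS_def)
    then obtain f n where fn: "f \<in> F" "n \<in> N" "x = f \<otimes> n" using F by (blast elim: set_multE)
    then have "f \<in> carrier G" "n \<in> carrier G" using F normal_subset[OF assms(1)] by auto
    \<comment> \<open>Normality turns the left coset of the cover into a right coset, the form in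
      which the elements of \<open>G Mod N\<close> are given.\<close>
    then have "x = (f \<otimes> n \<otimes> inv f) \<otimes> f" "f \<otimes> n \<otimes> inv f \<in> N"
      using fn normal_conj[OF assms(1)] by (simp add: m_assoc, blast)
    then have "C = N #> f"
      using x coset_mult_normal_left[OF assms(1)] \<open>f \<in> carrier G\<close> by metis
    then show "C \<in> (\<lambda>f. N #> f) ` F" using fn by blast
  qed
  then show ?thesis using F(1) finite_surj by blast
qed

text \<open>Lagrange's theorem in the finite group \<open>G Mod N\<close>, with its order as
  \<open>m\<close>.\<close>

lemma exponent_of_finite_index:
  assumes "N \<lhd> G" "finite_index_in N (carrier G)"
  obtains m :: nat where "0 < m" "\<And>x. x \<in> carrier G \<Longrightarrow> x [^] m \<in> N"
proof
  interpret Q: group "G Mod N" by (rule normal.factorgroup_is_group[OF assms(1)])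
  interpret h: group_hom G "G Mod N" "\<lambda>x. N #> x"
    by (simp add: group_hom_def group_hom_axioms_def group_axioms Q.group_axioms
        normal.r_coset_hom_Mod[OF assms(1)])
  show "0 < order (G Mod N)"
    using finite_factor_group[OF assms] by (simp add: Q.order_gt_0_iff_finite)
  fix x assume x: "x \<in> carrier G"
  have "N #> (x [^] order (G Mod N)) = \<one>\<^bsub>G Mod N\<^esub>"
    using x h.hom_nat_pow[OF x] Q.pow_order_eq_1[OF h.hom_closed[OF x]] by simp
  then show "x [^] order (G Mod N) \<in> N"
    using coset_join1[OF _ nat_pow_closed[OF x] normal_imp_subgroup[OF assms(1)]]
    by (simp add: FactGroup_def)
qed

end

section \<open>Finiteness in finitely generated groups\<close>

context profinite_group
begin

lemma iterated_commutators_subset_lcs: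
  assumes "A \<subseteq> E" "closed_normal G T E"
  shows "iterated_commutators A n \<subseteq> lcs (Suc n) E"
proof (induction n)
  case (Suc n)
  then show ?case
    using assms by (auto simp del: lower_central.simps intro!: commutator_in_lcs)
qed (use assms in auto)

text \<open>Modulo the next term of the series the commutator is multiplicative in each entry, so
  commutators of generators generate. The induction step extends this from generators to arbitrary
  entries, first on the right and then on the left.\<close>

lemma lcs_generated_by_iterated_commutators:
  assumes A: "A \<subseteq> carrier G" "closed_generate G T A = E" and E: "closed_normal G T E"
  shows "lcs (Suc n) E \<subseteq> closed_generate G T (iterated_commutators A n \<union> lcs (Suc (Suc n)) E)"
proof -
  have AE: "A \<subseteq> E" using closed_generate_superset[OF A(1)] A(2) by simp
  note Ed = closed_normalD[OF E]
  have cl: "closed_normal G T (lcs i E)" for i by (rule closed_normal_lcs[OF E])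
  have lc: "lcs i E \<subseteq> carrier G" for i using closed_normalD(4)[OF cl] .
  note ic = iterated_commutators_subset_lcs[OF AE E]
  show "lcs (Suc n) E \<subseteq> closed_generate G T (iterated_commutators A n \<union> lcs (Suc (Suc n)) E)"
  proof (induction n)
    case 0
    then show ?case using A(2) closed_generate_mono[of A "A \<union> lcs 2 E"]
      by (simp add: numeral_2_eq_2 closed_generate_mono)
  next
    case (Suc n)
    define S where "S = iterated_commutators A (Suc n) \<union> lcs (Suc (Suc (Suc n))) E"
    define P where "P = closed_generate G T S"
    have Ssub: "S \<subseteq> lcs (Suc (Suc n)) E"
      using ic[of "Suc n"] lcs_Suc_subset[OF E, of "Suc (Suc n)"] by (simp only: S_def) blast
    then have Sc: "S \<subseteq> carrier G" using lc by blast
    have P: "subgroup P G" "closedin T P" "S \<subseteq> P"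
      using Sc by (auto simp: P_def subgroup_closed_generate closedin_closed_generate
          dest: closed_generate_superset)
    \<comment> \<open>Conjugation multiplies a generator \<open>z\<close> by a commutator with an
      element of \<open>E\<close>; this commutator lies one term deeper, in the part of
      \<open>S\<close> taken from the series.\<close>
    have conj: "x \<otimes> p \<otimes> inv x \<in> P" if "x \<in> E" "p \<in> P" for x p
      unfolding P_def
    proof (rule closed_generate_conj[OF Sc])
      show "p \<in> closed_generate G T S" using that by (simp add: P_def)
      show xc: "x \<in> carrier G" using that Ed by blast
      fix z assume z: "z \<in> S"
      then have zc: "z \<in> carrier G" using Sc by blast
      have "cmt z x \<in> lcs (Suc (Suc (Suc n))) E"
        using z Ssub that(1) by (intro commutator_in_lcs[OF E]) auto
      then have "inv (cmt z x) \<in> P"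
        using P by (intro subgroup.m_inv_closed) (auto simp only: S_def)
      then have "cmt x z \<otimes> z \<in> P"
        using z P zc xc by (auto simp: inv_commutator intro: subgroup.m_closed)
      then show "x \<otimes> z \<otimes> inv x \<in> closed_generate G T S"
        using zc xc by (simp add: conj_eq_commutator_mult P_def)
    qed
    \<comment> \<open>Second entry: the admissible \<open>e\<close> form a closed subgroup that
      contains \<open>A\<close>, hence all of \<open>E\<close>.\<close>
    have 1: "cmt x e \<in> P" if x: "x \<in> iterated_commutators A n" and e: "e \<in> E" for x e
    proof -
      have xE: "x \<in> E" using x ic[of n] lcs_subset[OF E, of "Suc n"] by blast
      then have xc: "x \<in> carrier G" using Ed by blast
      have eq: "{e \<in> E. cmt x e \<in> P} = E \<inter> {e \<in> carrier G. cmt x e \<in> P}" using Ed by blast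
      have "closed_generate G T A \<subseteq> {e \<in> E. cmt x e \<in> P}"
      proof (rule closed_generate_minimal)
        show "A \<subseteq> {e \<in> E. cmt x e \<in> P}"
          using AE x P(3) by (auto simp: S_def)
        show "subgroup {e \<in> E. cmt x e \<in> P} G"
          using subgroup_commutator_right_preimage[OF Ed(3) P(1) xc] conj by blast
        show "closedin T {e \<in> E. cmt x e \<in> P}"
          unfolding eq using xc by (intro closedin_Int Ed closedin_preimage continuous_intros_group P)
      qed
      then show ?thesis using e A(2) by blast
    qed
    \<comment> \<open>First entry: by the induction hypothesis it suffices to treat iterated
      commutators and \<open>lcs (Suc (Suc n)) E\<close>, and commutators with the latter lie in
      \<open>S\<close>.\<close>
    have 2: "cmt x e \<in> P" if x: "x \<in> lcs (Suc n) E" and e: "e \<in> E" for x e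
    proof -
      let ?Q = "{x \<in> lcs (Suc n) E. cmt x e \<in> P}"
      have ec: "e \<in> carrier G" using e Ed by blast
      have eq: "?Q = lcs (Suc n) E \<inter> {x \<in> carrier G. cmt x e \<in> P}" using lc by blast
      have "closed_generate G T (iterated_commutators A n \<union> lcs (Suc (Suc n)) E) \<subseteq> ?Q"
      proof (rule closed_generate_minimal)
        have "cmt x e \<in> P" if "x \<in> lcs (Suc (Suc n)) E" for x
          using commutator_in_lcs[OF E _ that e] P(3) by (auto simp only: S_def)
        then show "iterated_commutators A n \<union> lcs (Suc (Suc n)) E \<subseteq> ?Q"
          using 1 e ic[of n] lcs_Suc_subset[OF E, of "Suc n"] by blast
        show "subgroup ?Q G"
          using subgroup_commutator_left_preimage[OF closed_normalD(3)[OF cl] P(1) ec] conj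
            lcs_subset[OF E] by blast
        show "closedin T ?Q"
          unfolding eq using ec
          by (intro closedin_Int closed_normalD(2)[OF cl] closedin_preimage continuous_intros_group P)
      qed
      then show ?thesis using Suc x by blast
    qed
    have "closed_commutator G T (lcs (Suc n) E) E \<subseteq> P"
      using 2 P by (intro closed_commutator_minimal) auto
    then show ?case by (simp add: lcs_Suc P_def S_def)
  qed
qed

text \<open>Modulo the next term, multilinearity rewrites the power as the commutator of the
  \<open>m\<close>-th powers of the \<open>n + 1\<close> entries. These powers lie in
  \<open>V\<close>, and each entry accounts for one factor \<open>m\<close> of the exponent.\<close>

lemma iterated_commutators_pow:
  fixes m :: nat
  assumes A: "A \<subseteq> E" and E: "closed_normal G T E" and V: "closed_normal G T V"
    and m: "\<And>e. e \<in> E \<Longrightarrow> e [^] m \<in> V"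
    and x: "x \<in> iterated_commutators A n"
  shows "x [^] (m ^ Suc n) \<in> lcs (Suc n) V <#> lcs (Suc (Suc n)) E"
  using x
proof (induction n arbitrary: x)
  case 0
  then have "x \<in> E" using A by auto
  then have "x [^] m \<in> V" by (rule m)
  then show ?case
    using subset_set_mult_left[of V "lcs 2 E"] closed_normalD(4)[OF V] closed_normalD(5)[OF closed_normal_lcs[OF E]]
    by (auto simp: numeral_2_eq_2 simp del: lower_central.simps(3))
next
  case (Suc n)
  then obtain y a where ya: "y \<in> iterated_commutators A n" "a \<in> A" "x = cmt y a" by auto
  have cl: "closed_normal G T (lcs i E)" for i by (rule closed_normal_lcs[OF E])
  have clV: "closed_normal G T (lcs i V)" for i by (rule closed_normal_lcs[OF V])
  note ic = iterated_commutators_subset_lcs[OF A E]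
  have yD: "y \<in> lcs (Suc n) E" using ya ic by blast
  have yE: "y \<in> E" using yD lcs_subset[OF E] by blast
  have aE: "a \<in> E" using ya A by blast
  have yc: "y \<in> carrier G" and ac: "a \<in> carrier G" using yE aE closed_normalD(4)[OF E] by auto
  let ?N = "lcs (Suc (Suc (Suc n))) E"
  note N = closed_normalD[OF cl[of "Suc (Suc (Suc n))"]]
  let ?q = "m ^ Suc n"
  have powE: "z [^] k \<in> E" if "z \<in> E" for z and k :: nat
    using that closed_normalD(3)[OF E] by (induction k) (auto intro: subgroup.m_closed subgroup.one_closed)
  have powD: "y [^] k \<in> lcs (Suc n) E" for k :: nat
    using yD closed_normalD(3)[OF cl] by (induction k) (auto intro: subgroup.m_closed subgroup.one_closed)
  have D2: "cmt (y [^] k) e \<in> lcs (Suc (Suc n)) E" if "e \<in> E" for e and k :: nat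
    using powD that by (intro commutator_in_lcs[OF E]) auto
  have N1: "cmt z w \<in> ?N" if "z \<in> lcs (Suc (Suc n)) E" "w \<in> E" for z w
    using that by (intro commutator_in_lcs[OF E]) auto
  have N2: "cmt w z \<in> ?N" if "z \<in> lcs (Suc (Suc n)) E" "w \<in> E" for z w
  proof -
    have "inv (cmt z w) \<in> ?N" using N1[OF that] N(3) by (rule subgroup.m_inv_closed[rotated])
    moreover have "z \<in> carrier G" "w \<in> carrier G"
      using that closed_normalD(4)[OF cl] closed_normalD(4)[OF E] by blast+
    ultimately show ?thesis by (simp only: inv_commutator)
  qed
  \<comment> \<open>Move the exponent \<open>m\<close> out of the right entry and then
    \<open>?q\<close> out of the left one; both error terms fall into \<open>?N\<close>.\<close>
  have "?N #> cmt (y [^] ?q) (a [^] m) = ?N #> (cmt (y [^] ?q) a [^] m)"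
    using N2[OF D2[OF aE] powE[OF aE]] yc ac by (intro coset_commutator_pow_right[OF N(1)]) auto
  moreover have "?N #> cmt (y [^] ?q) a = ?N #> (cmt y a [^] ?q)"
    using N2[OF D2[OF aE] yE] yc ac by (intro coset_commutator_pow_left[OF N(1)]) auto
  then have "?N #> (cmt (y [^] ?q) a [^] m) = ?N #> ((cmt y a [^] ?q) [^] m)"
    using yc ac by (intro coset_pow_cong[OF N(1)]) auto
  ultimately have eq: "?N #> cmt (y [^] ?q) (a [^] m) = ?N #> (x [^] (m ^ Suc (Suc n)))"
    using yc ac ya(3) by (simp add: nat_pow_pow mult.commute)
  let ?W = "lcs (Suc (Suc n)) V <#> ?N"
  have W: "closed_normal G T ?W" by (intro closed_normal_set_mult cl clV)
  note Wd = closed_normalD[OF W]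
  have NW: "?N \<subseteq> ?W"
    by (intro subset_set_mult_right N closed_normalD(5)[OF clV])
  have VW: "lcs (Suc (Suc n)) V \<subseteq> ?W"
    by (intro subset_set_mult_left N closed_normalD(4)[OF clV])
  \<comment> \<open>By the induction hypothesis the left entry is \<open>v \<otimes> d\<close>. The
    commutator of \<open>v\<close> with \<open>a [^] m\<close> stays in the series of
    \<open>V\<close>, that of \<open>d\<close> falls into \<open>?N\<close>.\<close>
  obtain v d where vd: "v \<in> lcs (Suc n) V" "d \<in> lcs (Suc (Suc n)) E" "y [^] ?q = v \<otimes> d"
    using Suc.IH[OF ya(1)] by (rule set_multE)
  have vc: "v \<in> carrier G" and dc: "d \<in> carrier G"
    using vd closed_normalD(4)[OF clV] closed_normalD(4)[OF cl] by blast+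
  have "cmt v (a [^] m) \<in> ?W"
    using commutator_in_lcs[OF V _ vd(1) m[OF aE]] VW by auto
  moreover have "v \<otimes> cmt d (a [^] m) \<otimes> inv v \<in> ?W"
    using N1[OF vd(2) powE[OF aE]] NW vc by (intro normal_conj[OF Wd(1)]) auto
  ultimately have inW: "cmt (y [^] ?q) (a [^] m) \<in> ?W"
    using vd(3) vc dc ac Wd(3) by (simp add: commutator_mult_left subgroup.m_closed)
  have "x [^] (m ^ Suc (Suc n)) \<in> ?N #> cmt (y [^] ?q) (a [^] m)"
    unfolding eq using ya(3) yc ac N(3) by (intro rcos_self) auto
  then obtain z where z: "z \<in> ?N" "x [^] (m ^ Suc (Suc n)) = z \<otimes> cmt (y [^] ?q) (a [^] m)"
    unfolding r_coset_def by blast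
  show ?case
    unfolding z(2) using subgroup.m_closed[OF Wd(3) subsetD[OF NW z(1)] inW] .
qed

text \<open>\<open>D / W\<close> is abelian and topologically generated by finitely many torsion
  elements. Adjoining them one at a time produces finite unions of cosets of \<open>W\<close>; these
  are closed, so no further closure has to be taken.\<close>

lemma finite_index_abelian_torsion:
  fixes M :: nat
  assumes D: "closed_normal G T D" and W: "closed_normal G T W" "W \<subseteq> D"
    and comm: "\<And>x y. \<lbrakk>x \<in> D; y \<in> D\<rbrakk> \<Longrightarrow> cmt x y \<in> W"
    and C: "finite C" "C \<subseteq> D" "0 < M" "\<And>x. x \<in> C \<Longrightarrow> x [^] M \<in> W"
    and gen: "D \<subseteq> closed_generate G T (C \<union> W)"
  shows "finite_index_in W D"
proof -
  have "\<exists>S F. subgroup S G \<and> closedin T S \<and> W \<subseteq> S \<and> S \<subseteq> D \<and> C \<subseteq> S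
      \<and> finite F \<and> F \<subseteq> carrier G \<and> S = F <#> W"
    using C
  proof (induction C rule: finite_induct)
    case empty
    have "W = {\<one>} <#> W" using closed_normalD(4)[OF W(1)] by (force simp: set_mult_def)
    then show ?case using closed_normalD[OF W(1)] W(2) by (intro exI[of _ W] exI[of _ "{\<one>}"]) auto
  next
    case (insert c C)
    then obtain S F where S: "subgroup S G" "closedin T S" "W \<subseteq> S" "S \<subseteq> D" "C \<subseteq> S"
      and F: "finite F" "F \<subseteq> carrier G" "S = F <#> W" by auto
    have cD: "c \<in> D" and cM: "c [^] M \<in> S" using insert.prems S(3) by auto
    note Dd = closed_normalD[OF D]
    have cc: "c \<in> carrier G" using cD Dd by blast
    have Sc: "S \<subseteq> carrier G" using S(1) by (rule subgroup.subset)
    \<comment> \<open>\<open>D\<close> is abelian modulo \<open>W\<close> and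
      \<open>W \<subseteq> S\<close>, hence conjugation by \<open>D\<close> moves \<open>s\<close>
      only within its coset of \<open>W\<close>.\<close>
    have conj: "x \<otimes> s \<otimes> inv x \<in> S" if "x \<in> D" "s \<in> S" for x s
    proof -
      have "cmt x s \<otimes> s \<in> S" using comm[of x s] that S by (auto intro: subgroup.m_closed)
      then show ?thesis using that Dd(4) Sc by (subst conj_eq_commutator_mult) auto
    qed
    have powD: "c [^] k \<in> D" for k :: nat
      using cD Dd(3) by (induction k) (auto intro: subgroup.m_closed subgroup.one_closed)
    have powS: "c [^] (M * k) \<in> S" for k :: nat
    proof -
      have "(c [^] M) [^] k \<in> S"
        using cM S(1) by (induction k) (auto intro: subgroup.m_closed subgroup.one_closed)
      then show ?thesis using cc by (simp add: nat_pow_pow)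
    qed
    \<comment> \<open>Exponents below \<open>M\<close> are enough, since \<open>c [^] M\<close>
      already lies in \<open>S\<close>; the finiteness of \<open>P\<close> keeps \<open>S'\<close>
      closed and a finite union of cosets of \<open>W\<close>.\<close>
    define P where "P = (\<lambda>k. c [^] k) ` {..<M}"
    define S' where "S' = P <#> S"
    have Pc: "P \<subseteq> carrier G" "finite P" using cc by (auto simp: P_def)
    \<comment> \<open>Unbounded exponents make the subgroup axioms easy to check; reduction modulo
      \<open>M\<close> restores the bound.\<close>
    have S'_iff: "x \<in> S' \<longleftrightarrow> (\<exists>(k::nat) s. s \<in> S \<and> x = c [^] k \<otimes> s)" for x
    proof
      assume "x \<in> S'" then show "\<exists>(k::nat) s. s \<in> S \<and> x = c [^] k \<otimes> s"
        by (auto simp: S'_def P_def set_mult_def)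
    next
      assume "\<exists>(k::nat) s. s \<in> S \<and> x = c [^] k \<otimes> s"
      then obtain k s where ks: "s \<in> S" "x = c [^] (k::nat) \<otimes> s" by blast
      have "c [^] k = c [^] (k mod M) \<otimes> c [^] (M * (k div M))"
        using cc by (simp add: nat_pow_mult)
      then have "x = c [^] (k mod M) \<otimes> (c [^] (M * (k div M)) \<otimes> s)"
        using ks cc Sc by (auto simp: m_assoc)
      moreover have "c [^] (M * (k div M)) \<otimes> s \<in> S"
        using ks powS S(1) by (blast intro: subgroup.m_closed)
      moreover have "c [^] (k mod M) \<in> P" using \<open>0 < M\<close> by (auto simp: P_def)
      ultimately show "x \<in> S'" unfolding S'_def by (auto intro: set_multI)
    qed
    have "subgroup S' G"
    proof (rule subgroupI)
      show "S' \<subseteq> carrier G" unfolding S'_def by (intro setmult_subset_G Pc Sc)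
      have one: "\<one> \<in> S" using S(1) by (rule subgroup.one_closed)
      then show "S' \<noteq> {}" using S'_iff[of "c [^] (0::nat) \<otimes> \<one>"] by blast
      fix a assume a: "a \<in> S'"
      then obtain k s where ks: "s \<in> S" "a = c [^] (k::nat) \<otimes> s" by (auto simp: S'_iff)
      have sc: "s \<in> carrier G" using ks Sc by blast
      \<comment> \<open>To stay with natural exponents, the inverse of \<open>c [^] k\<close> is
        written as \<open>c [^] ?j\<close> times the inverse of \<open>c [^] (M * k)\<close>, the
        latter being in \<open>S\<close>.\<close>
      let ?j = "k * (M - 1)"
      let ?t = "inv (c [^] ?j) \<otimes> inv s \<otimes> c [^] ?j"
      have "?t = inv (c [^] ?j) \<otimes> inv s \<otimes> inv (inv (c [^] ?j))" using cc by simp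
      also have "\<dots> \<in> S"
        using powD Dd(3) ks S(1) by (intro conj) (auto intro: subgroup.m_inv_closed)
      finally have t: "?t \<otimes> inv (c [^] (M * k)) \<in> S"
        using powS S(1) by (auto intro: subgroup.m_closed subgroup.m_inv_closed)
      have "M * k = k + ?j" using \<open>0 < M\<close> by (cases M) auto
      then have "c [^] (M * k) = c [^] k \<otimes> c [^] ?j"
        using cc by (simp add: nat_pow_mult)
      then have "inv a = c [^] ?j \<otimes> (?t \<otimes> inv (c [^] (M * k)))"
        using ks cc sc by (simp add: inv_mult_group m_assoc)
      then show "inv a \<in> S'" unfolding S'_iff using t by blast
      fix b assume "b \<in> S'"
      then obtain l r where lr: "r \<in> S" "b = c [^] (l::nat) \<otimes> r" by (auto simp: S'_iff)
      have rc: "r \<in> carrier G" using lr Sc by blast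
      let ?u = "inv (c [^] l) \<otimes> s \<otimes> c [^] l"
      have "?u = inv (c [^] l) \<otimes> s \<otimes> inv (inv (c [^] l))" using cc by simp
      also have "\<dots> \<in> S"
        using powD Dd(3) ks by (intro conj) (auto intro: subgroup.m_inv_closed)
      finally have "?u \<otimes> r \<in> S" using lr S(1) by (blast intro: subgroup.m_closed)
      moreover have "a \<otimes> b = c [^] (k + l) \<otimes> (?u \<otimes> r)"
        using ks lr cc sc rc by (simp add: m_assoc flip: nat_pow_mult)
      ultimately show "a \<otimes> b \<in> S'" unfolding S'_iff by blast
    qed
    moreover have "closedin T S'"
    proof -
      have "closedin T P"
        using Pc by (metis Hausdorff closedin_Hausdorff_finite topspace_eq)
      then show ?thesis unfolding S'_def using S(2) by (rule closedin_set_mult)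
    qed
    moreover have SS': "S \<subseteq> S'"
    proof
      fix s assume "s \<in> S"
      moreover then have "s = c [^] (0::nat) \<otimes> s" using Sc by auto
      ultimately show "s \<in> S'" unfolding S'_iff by blast
    qed
    moreover have "S' \<subseteq> D"
      unfolding S'_def using powD S(4) Dd(3) by (intro set_mult_subset_subgroup) (auto simp: P_def)
    moreover have "c \<in> S'"
      unfolding S'_iff using S(1) cc by (intro exI[of _ 1] exI[of _ \<one>]) (auto simp: subgroup.one_closed)
    moreover have "S' = (P <#> F) <#> W"
      unfolding S'_def F(3) using Pc F closed_normalD(4)[OF W(1)] by (simp add: set_mult_assoc)
    moreover have "finite (P <#> F)" "P <#> F \<subseteq> carrier G"
      using Pc F by (simp_all add: finite_set_mult setmult_subset_G)
    ultimately show ?case using S(3,5) by (intro exI[of _ S'] exI[of _ "P <#> F"]) auto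
  qed
  then obtain S F where S: "subgroup S G" "closedin T S" "W \<subseteq> S" "C \<subseteq> S"
      and F: "finite F" "F \<subseteq> carrier G" "S = F <#> W" by blast
  then have "D \<subseteq> S" using gen closed_generate_minimal[of "C \<union> W" S] by blast
  then show ?thesis unfolding finite_index_in_def using F by blast
qed

section \<open>Finite generation of open subgroups and finite index along the lower central
  series\<close>

lemma finite_index_in_open_subgroup:
  assumes "subgroup H G" "openin T H"
  shows "finite_index_in H (carrier G)"
  using finite_cover_open_subgroup[OF assms] unfolding finite_index_in_def by (metis order_refl)

text \<open>A dense set meets every open set densely, and the open subgroup \<open>E\<close> is also
  closed.\<close>

lemma dense_Int_open_subgroup:
  assumes "A \<subseteq> carrier G" "closed_generate G T A = carrier G" "subgroup E G" "openin T E"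
  shows "T closure_of (E \<inter> generate G A) = E"
proof -
  have "E \<inter> T closure_of (generate G A) = E"
    using assms(2) subgroup.subset[OF assms(3)] by (auto simp: closed_generate_def)
  then have "E \<subseteq> T closure_of (E \<inter> generate G A)"
    using openin_Int_closure_of_subset[OF assms(4), of "generate G A"] by simp
  moreover have "T closure_of (E \<inter> generate G A) \<subseteq> E"
    using open_subgroup_closed[OF assms(3,4)] by (intro closure_of_minimal) auto
  ultimately show ?thesis by blast
qed

text \<open>Schreier's argument: the products \<open>t \<otimes> s \<otimes> inv u\<close> in
  \<open>E\<close>, with \<open>t\<close> and \<open>u\<close> from a finite set of representatives
  of the right cosets of \<open>E\<close>, generate a subgroup containing all elements of
  \<open>E\<close> in the abstract group generated by \<open>S\<close>. These are dense in
  \<open>E\<close>.\<close>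

lemma open_subgroup_topologically_fg:
  assumes fg: "topologically_fg G T" and E: "subgroup E G" "openin T E"
  obtains A where "finite A" "A \<subseteq> carrier G" "closed_generate G T A = E"
proof -
  obtain S where S: "finite S" "S \<subseteq> carrier G" "closed_generate G T S = carrier G"
    using fg unfolding topologically_fg_def by blast
  obtain F where F: "finite F" "F \<subseteq> carrier G" "carrier G = F <#> E"
    using finite_cover_open_subgroup[OF E] by blast
  \<comment> \<open>Inverses turn the left cosets of the cover into right cosets;
    \<open>\<one>\<close> serves as the starting point and in the product
    \<open>t \<otimes> \<one> \<otimes> inv \<one>\<close> below.\<close>
  define R where "R = insert \<one> ((\<lambda>f. inv f) ` F)"
  have R: "finite R" "R \<subseteq> carrier G" "\<one> \<in> R"
    using F(1) subsetD[OF F(2)] by (auto simp: R_def)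
  have cover: "\<exists>t\<in>R. x \<otimes> inv t \<in> E" if x: "x \<in> carrier G" for x
  proof -
    obtain f e where fe: "f \<in> F" "e \<in> E" "inv x = f \<otimes> e"
      using F(3) inv_closed[OF x] by (auto elim: set_multE)
    then have fec: "f \<in> carrier G" "e \<in> carrier G" using F E subgroup.subset by blast+
    have "x = inv (inv x)" using x by simp
    also have "\<dots> = inv e \<otimes> inv f" unfolding fe(3) using fec by (simp add: inv_mult_group)
    finally have "x \<otimes> inv (inv f) = inv e" using fec by (simp add: m_assoc)
    then have "x \<otimes> inv (inv f) \<in> E" using fe E(1) by (simp add: subgroup.m_inv_closed)
    moreover have "inv f \<in> R" using fe by (simp add: R_def)
    ultimately show ?thesis by blast
  qed
  define S' where "S' = S \<union> (\<lambda>s. inv s) ` S \<union> {\<one>}"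
  have S': "finite S'" "S' \<subseteq> carrier G" using S by (auto simp: S'_def)
  define A where "A = E \<inter> (\<lambda>(t, s, u). t \<otimes> s \<otimes> inv u) ` (R \<times> S' \<times> R)"
  have A: "finite A" "A \<subseteq> carrier G" "A \<subseteq> E"
    using R S' E(1) subgroup.subset by (auto simp: A_def)
  have genA: "subgroup (generate G A) G" "generate G A \<subseteq> E"
    using generate_is_subgroup[OF A(2)] generate_subgroup_incl[OF A(3) E(1)] by auto
  \<comment> \<open>The representative absorbs the generator: \<open>t \<otimes> s\<close> lies in
    some coset \<open>E u\<close>, and \<open>t \<otimes> s \<otimes> inv u\<close> is one of the
    elements of \<open>A\<close>.\<close>
  have step: "x \<otimes> s \<in> generate G A <#> R" if x: "x \<in> generate G A <#> R" and s: "s \<in> S'" for x s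
  proof -
    obtain a t where at: "a \<in> generate G A" "t \<in> R" "x = a \<otimes> t" using x by (rule set_multE)
    have c: "a \<in> carrier G" "t \<in> carrier G" "s \<in> carrier G"
      using at s R S' genA(2) E(1) subgroup.subset by blast+
    then obtain u where u: "u \<in> R" "(t \<otimes> s) \<otimes> inv u \<in> E" using cover[of "t \<otimes> s"] by auto
    then have "(t \<otimes> s) \<otimes> inv u \<in> A" using at s by (force simp: A_def)
    then have "a \<otimes> (t \<otimes> s \<otimes> inv u) \<in> generate G A"
      using at genA(1) by (auto intro: generate.incl subgroup.m_closed)
    moreover have "x \<otimes> s = a \<otimes> (t \<otimes> s \<otimes> inv u) \<otimes> u"
      using at c u R by (simp add: m_assoc subset_iff)
    ultimately show ?thesis using u by (auto intro: set_multI)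
  qed
  have act: "x \<otimes> g \<in> generate G A <#> R" if "g \<in> generate G S" "x \<in> generate G A <#> R" for x g
    using that
  proof (induction g arbitrary: x rule: generate.induct)
    case one
    then show ?case using step[of x \<one>] by (simp add: S'_def)
  next
    case (eng g h)
    have "x \<in> carrier G"
      using eng.prems genA R E(1) subgroup.subset setmult_subset_G[of "generate G A" R] by blast
    then have "x \<otimes> (g \<otimes> h) = (x \<otimes> g) \<otimes> h"
      using eng.hyps generate_in_carrier[OF S(2)] by (simp add: m_assoc)
    then show ?case using eng by simp
  qed (auto intro!: step simp: S'_def)
  \<comment> \<open>Letting \<open>g\<close> act on \<open>\<one>\<close> gives
    \<open>g = a \<otimes> t\<close>, where \<open>t\<close> lies in \<open>E\<close> and so is
    itself one of the elements of \<open>A\<close>.\<close>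
  have "E \<inter> generate G S \<subseteq> generate G A"
  proof
    fix g assume g: "g \<in> E \<inter> generate G S"
    then have gc: "g \<in> carrier G" using E(1) subgroup.subset by blast
    have "\<one> \<otimes> \<one> \<in> generate G A <#> R" by (intro set_multI generate.one R)
    then have "g \<in> generate G A <#> R" using act[of g \<one>] g gc by simp
    then obtain a t where at: "a \<in> generate G A" "t \<in> R" "g = a \<otimes> t" by (rule set_multE)
    have c: "a \<in> carrier G" "t \<in> carrier G"
      using at R genA(2) E(1) subgroup.subset by blast+
    then have "t = inv a \<otimes> g" using at by simp
    moreover have "inv a \<in> E" using at genA(2) subgroup.m_inv_closed[OF E(1)] by blast
    ultimately have "t \<in> E" using g subgroup.m_closed[OF E(1), of "inv a" g] by simp
    moreover have "t = t \<otimes> \<one> \<otimes> inv \<one>" using c by simp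
    ultimately have "t \<in> A" unfolding A_def using at R by (force simp: S'_def)
    then show "g \<in> generate G A"
      using at genA(1) by (auto intro: generate.incl subgroup.m_closed)
  qed
  then have "T closure_of (E \<inter> generate G S) \<subseteq> closed_generate G T A"
    by (simp add: closed_generate_def closure_of_mono)
  moreover have "closed_generate G T A \<subseteq> E"
    using A(3) E(1) open_subgroup_closed[OF E] by (rule closed_generate_minimal)
  ultimately have "closed_generate G T A = E"
    using dense_Int_open_subgroup[OF S(2,3) E] by blast
  then show thesis using that A by blast
qed

text \<open>The factor is abelian and generated by the finitely many iterated commutators of
  \<open>A\<close>. These are torsion because \<open>c \<le> n\<close> puts
  \<open>lcs (Suc n) V\<close> inside \<open>N\<close>.\<close>

lemma finite_index_lcs_step:
  fixes m :: nat
  assumes A: "finite A" "A \<subseteq> carrier G" "closed_generate G T A = E" and E: "closed_normal G T E"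
    and V: "closed_normal G T V" and N: "closed_normal G T N" and VN: "lcs (Suc c) V \<subseteq> N"
    and m: "0 < m" "\<And>e. e \<in> E \<Longrightarrow> e [^] m \<in> V" and n: "c \<le> n"
  shows "finite_index_in (lcs (Suc (Suc n)) E <#> N) (lcs (Suc n) E <#> N)"
proof -
  let ?L = "lcs (Suc n) E" and ?L' = "lcs (Suc (Suc n)) E"
  let ?D = "?L <#> N" and ?W = "?L' <#> N" and ?C = "iterated_commutators A n"
  have cl: "closed_normal G T (lcs i E)" for i by (rule closed_normal_lcs[OF E])
  have AE: "A \<subseteq> E" using closed_generate_superset[OF A(2)] A(3) by simp
  have D: "closed_normal G T ?D" and W: "closed_normal G T ?W"
    by (intro closed_normal_set_mult cl N)+
  note Nd = closed_normalD[OF N] and Wd = closed_normalD[OF W]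
  have L'W: "?L' \<subseteq> ?W" by (intro subset_set_mult_left closed_normalD(4)[OF cl] Nd)
  have NW: "N \<subseteq> ?W" by (intro subset_set_mult_right closed_normalD(5)[OF cl] Nd)
  have LD: "?L \<subseteq> ?D" by (intro subset_set_mult_left closed_normalD(4)[OF cl] Nd)
  show ?thesis
  proof (rule finite_index_abelian_torsion[OF D W])
    show "?W \<subseteq> ?D" by (intro mono_set_mult lcs_Suc_subset[OF E] order_refl)
    show "finite ?C" by (rule finite_iterated_commutators[OF A(1)])
    show "?C \<subseteq> ?D" using iterated_commutators_subset_lcs[OF AE E] LD by blast
    show "0 < m ^ Suc n" using m(1) by simp
    show "x [^] (m ^ Suc n) \<in> ?W" if "x \<in> ?C" for x
    proof -
      have "lcs (Suc n) V \<subseteq> ?W"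
        using lcs_antimono[OF V, of "Suc c" "Suc n"] n VN NW by auto
      then have "lcs (Suc n) V <#> ?L' \<subseteq> ?W"
        using L'W Wd(3) by (rule set_mult_subset_subgroup)
      then show ?thesis using iterated_commutators_pow[OF AE E V m(2) that] by blast
    qed
    show "cmt x y \<in> ?W" if xy: "x \<in> ?D" "y \<in> ?D" for x y
    proof (rule commutators_set_mult[OF Wd(1) closed_normalD(4)[OF cl] Nd(4) _ xy])
      fix x y assume *: "x \<in> ?L \<union> N" "y \<in> ?L \<union> N"
      then have c: "x \<in> carrier G" "y \<in> carrier G" using closed_normalD(4)[OF cl] Nd(4) by auto
      consider "x \<in> N" | "y \<in> N" | "x \<in> ?L" "y \<in> ?L" using * by blast
      then show "cmt x y \<in> ?W"
      proof cases
        case 1 then show ?thesis using NW c Nd(1) commutator_in_normal_left by blast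
      next
        case 2 then show ?thesis using NW c Nd(1) commutator_in_normal_right by blast
      next
        case 3
        then have "y \<in> E" using lcs_subset[OF E] by blast
        then have "cmt x y \<in> ?L'" using 3 by (intro commutator_in_lcs[OF E]) auto
        then show ?thesis using L'W by blast
      qed
    qed
    let ?P = "closed_generate G T (?C \<union> ?W)"
    have sub: "?C \<union> ?W \<subseteq> carrier G"
      using iterated_commutators_subset_lcs[OF AE E] closed_normalD(4)[OF cl] Wd(4) by blast
    have "?L \<subseteq> closed_generate G T (?C \<union> ?L')"
      by (rule lcs_generated_by_iterated_commutators[OF A(2,3) E])
    also have "\<dots> \<subseteq> ?P" using L'W by (intro closed_generate_mono) blast
    finally have "?L \<subseteq> ?P" .
    moreover have "N \<subseteq> ?P" using closed_generate_superset[OF sub] NW by blast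
    ultimately show "?D \<subseteq> ?P"
      by (rule set_mult_subset_subgroup[OF _ _ subgroup_closed_generate[OF sub]])
  qed
qed

text \<open>Telescopes the single steps from index \<open>c + 1\<close> to \<open>c + k + 1\<close>,
  with one \<open>m\<close> for all of them, an exponent of the finite group
  \<open>G / V\<close>.\<close>

lemma finite_index_lcs:
  assumes fg: "topologically_fg G T" and E: "open_normal G T E" and V: "open_normal G T V"
    and N: "closed_normal G T N" and VN: "lcs (Suc c) V \<subseteq> N"
  shows "finite_index_in (lcs (Suc (c + k)) E <#> N) (lcs (Suc c) E <#> N)"
proof -
  note Ec = open_normal_imp_closed_normal[OF E] and Vc = open_normal_imp_closed_normal[OF V]
  obtain A where A: "finite A" "A \<subseteq> carrier G" "closed_generate G T A = E"
    using open_subgroup_topologically_fg[OF fg] open_normalD[OF E] by blast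
  obtain m :: nat where m: "0 < m" "\<And>x. x \<in> carrier G \<Longrightarrow> x [^] m \<in> V"
    using exponent_of_finite_index[of V] finite_index_in_open_subgroup[of V] open_normalD[OF V]
    by blast
  have W: "lcs i E <#> N \<subseteq> carrier G" for i
    using closed_normalD(4)[OF closed_normal_set_mult[OF closed_normal_lcs[OF Ec] N]] .
  show ?thesis
  proof (induction k)
    case 0
    then show ?case using finite_index_in_refl[OF W[of "Suc c"]] by simp
  next
    case (Suc k)
    have "finite_index_in (lcs (Suc (Suc (c + k))) E <#> N) (lcs (Suc (c + k)) E <#> N)"
      using m(2) open_normalD(5)[OF E]
      by (intro finite_index_lcs_step[OF A Ec Vc N VN m(1)]) auto
    then show ?case using finite_index_in_trans[OF _ Suc W] by (simp only: add_Suc_right)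
  qed
qed

text \<open>For \<open>E = K <#> V\<close>, the group \<open>lcs (Suc c) K <#> N\<close> lies
  between two groups that depend only on \<open>E\<close>, the smaller of finite index in the
  larger. Since \<open>V\<close> is open, only finitely many \<open>E\<close> contain it.\<close>

lemma finite_lcs_values:
  assumes fg: "topologically_fg G T" and V: "open_normal G T V"
    and N: "closed_normal G T N" and VN: "lcs (Suc c) V \<subseteq> N"
  shows "finite {lcs (Suc c) K <#> N |K. closed_normal G T K}"
proof -
  define \<E> where "\<E> = {E. open_normal G T E \<and> V \<subseteq> E}"
  define \<F> where "\<F> = (\<lambda>E. {Y. subgroup Y G \<and> lcs (Suc (c + c)) E <#> N \<subseteq> Y \<and> Y \<subseteq> lcs (Suc c) E <#> N})"
  note Vc = open_normal_imp_closed_normal[OF V]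
  have "finite {E. subgroup E G \<and> V \<subseteq> E \<and> E \<subseteq> carrier G}"
    using finite_intermediate_subgroups[of V "carrier G"] finite_index_in_open_subgroup[of V]
      open_normalD[OF V] by blast
  moreover have "\<E> \<subseteq> {E. subgroup E G \<and> V \<subseteq> E \<and> E \<subseteq> carrier G}"
    using open_normalD(4,5) by (simp add: \<E>_def Collect_mono)
  ultimately have "finite \<E>" using finite_subset by blast
  moreover have "finite (\<F> E)" if "E \<in> \<E>" for E
  proof -
    have E: "open_normal G T E" using that by (simp add: \<E>_def)
    have "lcs (Suc (c + c)) E <#> N \<subseteq> carrier G"
      using closed_normalD(4)[OF closed_normal_set_mult[OF closed_normal_lcs N]]
        open_normal_imp_closed_normal[OF E] by blast
    then show ?thesis
      unfolding \<F>_def using finite_index_lcs[OF fg E V N VN, of c]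
      by (intro finite_intermediate_subgroups)
  qed
  moreover have "{lcs (Suc c) K <#> N |K. closed_normal G T K} \<subseteq> (\<Union>E\<in>\<E>. \<F> E)"
  proof clarify
    fix K assume K: "closed_normal G T K"
    define E where "E = K <#> V"
    let ?Y = "lcs (Suc c) K <#> N"
    have Y: "closed_normal G T ?Y" by (intro closed_normal_set_mult closed_normal_lcs K N)
    have E: "open_normal G T E" unfolding E_def by (rule open_normal_set_mult[OF K V])
    have VE: "V \<subseteq> E"
      unfolding E_def by (intro subset_set_mult_right closed_normalD(4)[OF Vc] closed_normalD(5)[OF K])
    have KE: "K \<subseteq> E"
      unfolding E_def by (intro subset_set_mult_left closed_normalD(5)[OF Vc] closed_normalD(4)[OF K])
    have NY: "N \<subseteq> ?Y"
      by (intro subset_set_mult_right closed_normalD(4)[OF N] closed_normalD(5)[OF closed_normal_lcs[OF K]])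
    have KY: "lcs (Suc c) K \<subseteq> ?Y"
      by (intro subset_set_mult_left closed_normalD(5)[OF N] closed_normalD(4)[OF closed_normal_lcs[OF K]])
    \<comment> \<open>Fitting's theorem modulo \<open>?Y\<close>: both \<open>K\<close> and
      \<open>V\<close> have their term of index \<open>c + 1\<close> in \<open>?Y\<close>.\<close>
    have "lcs (Suc (c + c)) E \<subseteq> ?Y"
      using lcs_set_mult_subset[OF K Vc Y KY] VN NY unfolding E_def mult_2 by blast
    then have "lcs (Suc (c + c)) E <#> N \<subseteq> ?Y"
      using NY closed_normalD(3)[OF Y] by (rule set_mult_subset_subgroup)
    moreover have "?Y \<subseteq> lcs (Suc c) E <#> N"
      by (intro mono_set_mult lcs_mono KE order_refl)
    ultimately show "?Y \<in> (\<Union>E\<in>\<E>. \<F> E)"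
      using E VE closed_normalD(3)[OF Y] by (auto simp: \<E>_def \<F>_def simp del: lower_central.simps)
  qed
  ultimately show ?thesis using finite_subset by blast
qed

section \<open>Virtual nilpotency of the group and of its quotients\<close>

lemma virtually_nilpotent_iff:
  "virtually_nilpotent c G T \<longleftrightarrow> (\<exists>V. open_normal G T V \<and> lcs (Suc c) V = {\<one>})"
proof
  assume "virtually_nilpotent c G T"
  then obtain H where H: "subgroup H G" "openin T H" "lcs (Suc c) H = {\<one>}"
    by (auto simp: virtually_nilpotent_def open_subgroup_def)
  obtain V where V: "open_normal G T V" "V \<subseteq> H" using open_normal_core[OF H(1,2)] .
  have "lcs (Suc c) V \<subseteq> {\<one>}" using lcs_mono[OF V(2)] H(3) by metis
  moreover have "\<one> \<in> lcs (Suc c) V"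
    by (intro closed_normalD(5) closed_normal_lcs open_normal_imp_closed_normal V)
  ultimately show "\<exists>V. open_normal G T V \<and> lcs (Suc c) V = {\<one>}" using V by blast
next
  assume "\<exists>V. open_normal G T V \<and> lcs (Suc c) V = {\<one>}"
  then show "virtually_nilpotent c G T"
    using open_normalD unfolding virtually_nilpotent_def open_subgroup_def by (metis Suc_eq_plus1)
qed

text \<open>Both directions compare the series of \<open>V\<close> with a series in the quotient.
  Continuity of the projection sends terms into terms; conversely, images of closed normal subgroups
  are closed, so the terms for the image of \<open>V\<close> lie in the images of the terms.\<close>

lemma virtually_nilpotent_quotient_iff:
  assumes N: "closed_normal G T N"
  shows "virtually_nilpotent c (G Mod N) (quotient_topology G T N) \<longleftrightarrow>
    (\<exists>V. open_normal G T V \<and> lcs (Suc c) V \<subseteq> N)"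
proof -
  note Nd = closed_normalD[OF N]
  define Q where "Q = quotient_topology G T N"
  define p where "p = (\<lambda>x. N #> x)"
  interpret Q: group "G Mod N" by (rule normal.factorgroup_is_group[OF Nd(1)])
  interpret h: group_hom G "G Mod N" p
    unfolding p_def by (simp add: group_hom_def group_hom_axioms_def group_axioms Q.group_axioms
        normal.r_coset_hom_Mod[OF Nd(1)])
  have qm: "quotient_map T Q p"
    unfolding Q_def p_def by (rule quotient_map_quotient_topology[OF topspace_eq])
  have cont: "continuous_map T Q p" using qm by (rule quotient_imp_continuous_map)
  have pim: "p ` carrier G = carrier (G Mod N)" by (auto simp: p_def FactGroup_def RCOSETS_def)
  have topQ: "topspace Q = carrier (G Mod N)"
    using quotient_imp_surjective_map[OF qm] pim by (simp add: topspace_eq)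
  have pcmt: "commutator (G Mod N) (p x) (p y) = p (cmt x y)"
    if "x \<in> carrier G" "y \<in> carrier G" for x y
    using that by (simp add: commutator_def)
  have p_one: "p x = \<one>\<^bsub>G Mod N\<^esub> \<longleftrightarrow> x \<in> N" if "x \<in> carrier G" for x
    using coset_join1[OF _ that Nd(3)] coset_join2[OF that Nd(3)] by (auto simp: p_def FactGroup_def)
  let ?lcsQ = "lower_central (G Mod N) Q"
  have lcsQ_Suc: "?lcsQ (Suc i) H = closed_commutator (G Mod N) Q (?lcsQ i H) H" if "0 < i" for i H
    using that by (cases i) auto
  have image_lcs: "p ` lcs i V \<subseteq> ?lcsQ i H" if V: "closed_normal G T V" and VH: "p ` V \<subseteq> H" for V H i
  proof (induction i)
    case (Suc i)
    show ?case
    proof (cases "i = 0")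
      case False
      let ?S = "{cmt x y |x y. x \<in> lcs i V \<and> y \<in> V}"
      let ?S' = "{commutator (G Mod N) x y |x y. x \<in> ?lcsQ i H \<and> y \<in> H}"
      have S: "?S \<subseteq> carrier G"
        using closed_normalD(4)[OF V] closed_normalD(4)[OF closed_normal_lcs[OF V]]
        by (intro commutators_subset_carrier)
      have "p ` ?S \<subseteq> ?S'"
      proof clarify
        fix x y assume xy: "x \<in> lcs i V" "y \<in> V"
        then have "p (cmt x y) = commutator (G Mod N) (p x) (p y)"
          using closed_normalD(4)[OF V] closed_normalD(4)[OF closed_normal_lcs[OF V]]
          by (intro pcmt[symmetric]) auto
        then show "\<exists>x' y'. p (cmt x y) = commutator (G Mod N) x' y' \<and> x' \<in> ?lcsQ i H \<and> y' \<in> H"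
          using xy Suc VH by blast
      qed
      have "p ` lcs (Suc i) V \<subseteq> Q closure_of (p ` generate G ?S)"
        using continuous_map_image_closure_subset[OF cont] False
        by (simp add: lcs_Suc closed_commutator_eq closed_generate_def)
      also have "p ` generate G ?S = generate (G Mod N) (p ` ?S)"
        by (rule h.generate_img[OF S, symmetric])
      also have "Q closure_of generate (G Mod N) (p ` ?S) \<subseteq> Q closure_of generate (G Mod N) ?S'"
        using \<open>p ` ?S \<subseteq> ?S'\<close> by (intro closure_of_mono Q.mono_generate)
      also have "\<dots> = ?lcsQ (Suc i) H"
        using False by (simp add: lcsQ_Suc closed_commutator_eq closed_generate_def)
      finally show ?thesis .
    qed (use VH in auto)
  qed (use VH in auto)
  \<comment> \<open>The preimage of the image of \<open>V\<close> is \<open>N <#> V\<close>, which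
    is closed as a product of closed subgroups in a compact group.\<close>
  have closed_image: "closedin Q (p ` V)" if V: "closed_normal G T V" for V
  proof -
    have "{x \<in> topspace T. p x \<in> carrier (G Mod N) - p ` V} = topspace T - (N <#> V)"
    proof (intro equalityI subsetI)
      fix x assume x: "x \<in> topspace T - (N <#> V)"
      have "p x \<noteq> p v" if "v \<in> V" for v
      proof
        assume "p x = p v"
        then have "x \<in> N #> v"
          using x rcos_self[of x N] Nd(3) by (simp add: p_def topspace_eq)
        then have "x \<in> N <#> V" using \<open>v \<in> V\<close> by (auto simp: r_coset_def set_mult_def)
        then show False using x by blast
      qed
      then show "x \<in> {x \<in> topspace T. p x \<in> carrier (G Mod N) - p ` V}"
        using x pim by (auto simp: topspace_eq)
    next
      fix x assume x: "x \<in> {x \<in> topspace T. p x \<in> carrier (G Mod N) - p ` V}"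
      have "x \<notin> N <#> V"
      proof
        assume "x \<in> N <#> V"
        then obtain n v where nv: "n \<in> N" "v \<in> V" "x = n \<otimes> v" by (rule set_multE)
        then have "p x = p v"
          using coset_mult_normal_left[OF Nd(1)] closed_normalD(4)[OF V] by (auto simp: p_def)
        then show False using x nv by blast
      qed
      then show "x \<in> topspace T - (N <#> V)" using x by blast
    qed
    moreover have "openin T (topspace T - (N <#> V))"
      using closedin_set_mult[OF Nd(2) closed_normalD(2)[OF V]] by blast
    ultimately have "openin Q (carrier (G Mod N) - p ` V)"
      by (simp add: Q_def openin_quotient_topology p_def)
    then show ?thesis
      unfolding closedin_def topQ using pim closed_normalD(4)[OF V] by blast
  qed
  have lcs_image: "?lcsQ i (p ` V) \<subseteq> p ` lcs i V" if V: "closed_normal G T V" for V i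
  proof (induction i)
    case (Suc i)
    show ?case
    proof (cases "i = 0")
      case False
      note cl = closed_normal_lcs[OF V]
      have "generate (G Mod N) {commutator (G Mod N) x y |x y. x \<in> ?lcsQ i (p ` V) \<and> y \<in> p ` V}
          \<subseteq> p ` lcs (Suc i) V"
      proof (rule Q.generate_subgroup_incl)
        show "subgroup (p ` lcs (Suc i) V) (G Mod N)"
          by (rule h.subgroup_img_is_subgroup[OF closed_normalD(3)[OF cl]])
        show "{commutator (G Mod N) x y |x y. x \<in> ?lcsQ i (p ` V) \<and> y \<in> p ` V} \<subseteq> p ` lcs (Suc i) V"
        proof clarify
          fix x y assume x: "x \<in> ?lcsQ i (p ` V)" and y: "y \<in> V"
          obtain x' where x': "x' \<in> lcs i V" "x = p x'" using x Suc by blast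
          have "commutator (G Mod N) x (p y) = p (cmt x' y)"
            unfolding x'(2) using x' y closed_normalD(4)[OF V] closed_normalD(4)[OF cl]
            by (intro pcmt) auto
          moreover have "cmt x' y \<in> lcs (Suc i) V"
            using False x' y by (intro commutator_in_lcs[OF V]) auto
          ultimately show "commutator (G Mod N) x (p y) \<in> p ` lcs (Suc i) V" by blast
        qed
      qed
      then have "Q closure_of generate (G Mod N)
          {commutator (G Mod N) x y |x y. x \<in> ?lcsQ i (p ` V) \<and> y \<in> p ` V} \<subseteq> p ` lcs (Suc i) V"
        using closed_image[OF cl] by (rule closure_of_minimal)
      then show ?thesis
        using False by (simp add: lcsQ_Suc closed_commutator_eq closed_generate_def)
    qed simp
  qed simp
  show ?thesis
    unfolding Q_def[symmetric]
  proof
    assume "virtually_nilpotent c (G Mod N) Q"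
    then obtain H where H: "subgroup H (G Mod N)" "openin Q H" "?lcsQ (Suc c) H = {\<one>\<^bsub>G Mod N\<^esub>}"
      by (auto simp: virtually_nilpotent_def open_subgroup_def)
    \<comment> \<open>The preimage of \<open>H\<close> is an open subgroup; any open normal subgroup
      inside it serves as \<open>V\<close>.\<close>
    let ?P = "{x \<in> carrier G. p x \<in> H}"
    have "openin T ?P" using openin_continuous_map_preimage[OF cont H(2)] by (simp add: topspace_eq)
    moreover have "subgroup ?P G"
    proof (rule subgroupI)
      have "p \<one> \<in> H" using subgroup.one_closed[OF H(1)] by simp
      then show "?P \<noteq> {}" using one_closed by blast
      fix a assume a: "a \<in> ?P"
      then show "inv a \<in> ?P" using subgroup.m_inv_closed[OF H(1)] by simp
      fix b assume b: "b \<in> ?P"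
      then have "p a \<otimes>\<^bsub>G Mod N\<^esub> p b \<in> H" using a subgroup.m_closed[OF H(1)] by blast
      then show "a \<otimes> b \<in> ?P" using a b by (simp del: mult_FactGroup)
    qed auto
    ultimately obtain V where V: "open_normal G T V" "V \<subseteq> ?P" using open_normal_core by metis
    note Vc = open_normal_imp_closed_normal[OF V(1)]
    have "p ` V \<subseteq> H" using V(2) by blast
    then have img: "p ` lcs (Suc c) V \<subseteq> {\<one>\<^bsub>G Mod N\<^esub>}"
      using image_lcs[OF Vc, of H "Suc c"] H(3) by (simp only:)
    have "lcs (Suc c) V \<subseteq> N"
    proof
      fix x assume x: "x \<in> lcs (Suc c) V"
      then have "x \<in> carrier G" using closed_normalD(4)[OF closed_normal_lcs[OF Vc]] by blast
      moreover have "p x = \<one>\<^bsub>G Mod N\<^esub>" using x img by blast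
      ultimately show "x \<in> N" using p_one by blast
    qed
    then show "\<exists>V. open_normal G T V \<and> lcs (Suc c) V \<subseteq> N" using V(1) by blast
  next
    assume "\<exists>V. open_normal G T V \<and> lcs (Suc c) V \<subseteq> N"
    then obtain V where V: "open_normal G T V" "lcs (Suc c) V \<subseteq> N" by blast
    note Vc = open_normal_imp_closed_normal[OF V(1)]
    have "?lcsQ (Suc c) (p ` V) \<subseteq> p ` N" using lcs_image[OF Vc, of "Suc c"] V(2) by blast
    moreover have "p ` N \<subseteq> {\<one>\<^bsub>G Mod N\<^esub>}" using p_one Nd(4) by blast
    moreover have "p \<one> \<in> ?lcsQ (Suc c) (p ` V)"
      using image_lcs[OF Vc, of "p ` V" "Suc c"] closed_normalD(5)[OF closed_normal_lcs[OF Vc]] by blast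
    ultimately have "?lcsQ (Suc c) (p ` V) = {\<one>\<^bsub>G Mod N\<^esub>}" by auto
    moreover have "subgroup (p ` V) (G Mod N)"
      by (rule h.subgroup_img_is_subgroup[OF closed_normalD(3)[OF Vc]])
    moreover have "openin Q (p ` V)"
    proof -
      have "{x \<in> topspace T. p x \<in> p ` V} = N <#> V"
      proof (intro equalityI subsetI)
        fix x assume "x \<in> {x \<in> topspace T. p x \<in> p ` V}"
        then obtain v where v: "v \<in> V" "p x = p v" "x \<in> carrier G" by (auto simp: topspace_eq)
        then have "x \<in> N #> v" using rcos_self[of x N] Nd(3) by (simp add: p_def)
        then show "x \<in> N <#> V" using v by (auto simp: r_coset_def set_mult_def)
      next
        fix x assume "x \<in> N <#> V"
        then obtain n v where nv: "n \<in> N" "v \<in> V" "x = n \<otimes> v" by (rule set_multE)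
        then have "p x = p v" "x \<in> carrier G"
          using coset_mult_normal_left[OF Nd(1)] closed_normalD(4)[OF Vc] Nd(4) by (auto simp: p_def)
        then show "x \<in> {x \<in> topspace T. p x \<in> p ` V}" using nv by (auto simp: topspace_eq)
      qed
      moreover have "openin T (N <#> V)"
        using open_normal_set_mult[OF N V(1)] by (rule open_normalD)
      moreover have "p ` V \<subseteq> carrier (G Mod N)" using pim closed_normalD(4)[OF Vc] by blast
      ultimately show ?thesis by (simp add: Q_def openin_quotient_topology p_def)
    qed
    ultimately show "virtually_nilpotent c (G Mod N) Q"
      unfolding virtually_nilpotent_def open_subgroup_def by (metis Suc_eq_plus1)
  qed
qed

text \<open>A non-empty finite subfamily of a chain contains its own intersection, so compactness
  applies through the finite intersection property.\<close>

lemma chain_closed_Inter_nonempty: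
  assumes "\<C> \<noteq> {}" "\<And>C. C \<in> \<C> \<Longrightarrow> closedin T C \<and> C \<noteq> {}"
    and "\<And>C D. \<lbrakk>C \<in> \<C>; D \<in> \<C>\<rbrakk> \<Longrightarrow> C \<subseteq> D \<or> D \<subseteq> C"
  shows "\<Inter>\<C> \<noteq> {}"
proof -
  have "\<Inter>\<F> \<noteq> {}" if "finite \<F>" "\<F> \<subseteq> \<C>" for \<F>
  proof (cases "\<F> = {}")
    case False
    then have "\<Inter>\<F> \<in> \<F>"
      using that assms(3) by (intro Inter_in_chain[of _ \<C>]) (auto simp: subset.chain_def subset_eq)
    then show ?thesis using that assms(2) by blast
  qed simp
  then show ?thesis
    using compact assms(2) unfolding compact_space_fip by (elim allE[of _ \<C>]) auto
qed

end

section \<open>Just non-(nilpotent-by-finite) groups\<close>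

context profinite_group
begin

text \<open>Some \<open>x \<in> L\<close> lies outside \<open>A <#> U\<close> for a suitable
  \<open>U\<close>; the choice \<open>R = A <#> (L \<inter> U)\<close> still misses
  \<open>x\<close>.\<close>

lemma ex_proper_relatively_open_normal:
  assumes L: "closed_normal G T L" and A: "closed_normal G T A" "A \<subseteq> L" "A \<noteq> L"
  obtains R U where "closed_normal G T R" "open_normal G T U" "A \<subseteq> R" "R \<subseteq> L" "R \<noteq> L" "L \<inter> U \<subseteq> R"
proof -
  obtain x where x: "x \<in> L" "x \<notin> A" using A by blast
  then obtain U where U: "open_normal G T U" "x \<notin> A <#> U"
    using separate_by_open_normal[OF closed_normalD(2)[OF A(1)]] closed_normalD(4)[OF L] by blast
  have LU: "closed_normal G T (L \<inter> U)"
    by (intro closed_normal_Int L open_normal_imp_closed_normal U)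
  let ?R = "A <#> (L \<inter> U)"
  have R: "closed_normal G T ?R" by (rule closed_normal_set_mult[OF A(1) LU])
  show thesis
  proof
    show "A \<subseteq> ?R"
      by (intro subset_set_mult_left closed_normalD(4)[OF A(1)] closed_normalD(5)[OF LU])
    show "L \<inter> U \<subseteq> ?R"
      by (intro subset_set_mult_right closed_normalD(4)[OF LU] closed_normalD(5)[OF A(1)])
    show "?R \<subseteq> L" using A(2) closed_normalD(3)[OF L] by (intro set_mult_subset_subgroup) auto
    have "?R \<subseteq> A <#> U" by (intro mono_set_mult) auto
    then show "?R \<noteq> L" using x(1) U(2) by blast
  qed (use R U in auto)
qed

text \<open>After expanding both entries by the product rules, every commutator with an entry from
  \<open>R\<close> is absorbed by the normal subgroup \<open>R\<close>, and a commutator of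
  \<open>A\<close> with \<open>B\<close> remains.\<close>

lemma closed_commutator_set_mult_subset:
  assumes A: "closed_normal G T A" and B: "closed_normal G T B" and R: "closed_normal G T R"
  shows "closed_commutator G T (A <#> R) (B <#> R) \<subseteq> closed_commutator G T A B <#> R"
proof -
  let ?W = "closed_commutator G T A B <#> R"
  have AB: "closed_normal G T (closed_commutator G T A B)"
    by (rule closed_normal_closed_commutator[OF A B])
  have W: "closed_normal G T ?W" by (rule closed_normal_set_mult[OF AB R])
  note Wd = closed_normalD[OF W]
  have RW: "R \<subseteq> ?W" by (intro subset_set_mult_right closed_normalD(4)[OF R] closed_normalD(5)[OF AB])
  have ABW: "closed_commutator G T A B \<subseteq> ?W"
    by (intro subset_set_mult_left closed_normalD(4)[OF AB] closed_normalD(5)[OF R])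
  show ?thesis
  proof (rule closed_commutator_minimal[OF _ Wd(3,2)])
    fix x y assume "x \<in> A <#> R" "y \<in> B <#> R"
    then obtain a r b s where x: "a \<in> A" "r \<in> R" "x = a \<otimes> r" and y: "b \<in> B" "s \<in> R" "y = b \<otimes> s"
      by (auto simp: set_mult_def)
    have c: "a \<in> carrier G" "r \<in> carrier G" "b \<in> carrier G" "s \<in> carrier G"
      using x y closed_normalD(4) A B R by blast+
    have "cmt r y \<in> ?W"
      using commutator_in_normal_left[OF closed_normalD(1)[OF R] x(2), of y] RW y(3) c by auto
    then have 1: "a \<otimes> cmt r y \<otimes> inv a \<in> ?W" using normal_conj[OF Wd(1)] c by blast
    have 2: "cmt a b \<in> ?W"
      using commutator_in_closed_commutator[OF closed_normalD(4)[OF A] closed_normalD(4)[OF B] x(1) y(1)]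
        ABW by blast
    have "cmt a s \<in> ?W"
      using commutator_in_normal_right[OF closed_normalD(1)[OF R] c(1) y(2)] RW by blast
    then have "b \<otimes> cmt a s \<otimes> inv b \<in> ?W" using normal_conj[OF Wd(1)] c by blast
    with 2 have "cmt a y \<in> ?W"
      unfolding y(3) using c by (simp add: commutator_mult_right subgroup.m_closed[OF Wd(3)])
    with 1 show "cmt x y \<in> ?W"
      unfolding x(3) using c y(3) by (simp add: commutator_mult_left subgroup.m_closed[OF Wd(3)])
  qed
qed

text \<open>
  If some proper \<open>R\<close> that is relatively open in \<open>L\<close> satisfies \<open>[L, L] R = L\<close>, take \<open>N = B \<inter> R\<close> for a
  minimal \<open>B\<close> with \<open>B R = L\<close>: if \<open>A N = L\<close>, then \<open>[A, B] R = [L, L] R = L\<close>, so \<open>B = [A, B] \<le> A\<close>.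
  Otherwise \<open>N = [L, L]\<close> works.
\<close>

lemma ex_non_supplemented:
  assumes not_vn: "\<And>V. open_normal G T V \<Longrightarrow> lcs (Suc c) V \<noteq> {\<one>}"
    and quot_vn: "\<And>N. \<lbrakk>closed_normal G T N; N \<noteq> {\<one>}\<rbrakk> \<Longrightarrow> \<exists>V. open_normal G T V \<and> lcs (Suc c) V \<subseteq> N"
    and no_abelian:
      "\<not> (\<exists>N. closed_normal G T N \<and> (\<forall>x\<in>N. \<forall>y\<in>N. x \<otimes> y = y \<otimes> x) \<and> N \<noteq> {\<one>})"
    and L: "closed_normal G T L" "L \<noteq> {\<one>}"
  obtains N where "closed_normal G T N" "N \<noteq> {\<one>}" "N \<subseteq> L"
    "\<And>A. \<lbrakk>closed_normal G T A; A \<subseteq> L; A <#> N = L\<rbrakk> \<Longrightarrow> A = L"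
proof (cases "\<exists>R U. closed_normal G T R \<and> open_normal G T U \<and> R \<subseteq> L \<and> R \<noteq> L \<and> L \<inter> U \<subseteq> R
    \<and> closed_commutator G T L L <#> R = L")
  case True
  then obtain R U where R: "closed_normal G T R" "R \<subseteq> L" "R \<noteq> L" "closed_commutator G T L L <#> R = L"
    and U: "open_normal G T U" "L \<inter> U \<subseteq> R" by blast
  note Rd = closed_normalD[OF R(1)] and Ld = closed_normalD[OF L(1)]
  define \<B> where "\<B> = {B. closed_normal G T B \<and> B \<subseteq> L \<and> B <#> R = L}"
  have in\<B>: "B \<in> \<B>" if "closed_normal G T B" "B \<subseteq> L" "L \<subseteq> B <#> R" for B
    using that R(2) set_mult_subset_subgroup[of B L R] Ld(3) by (auto simp: \<B>_def)
  obtain B where B: "B \<in> \<B>" and B_min: "\<And>A. \<lbrakk>A \<in> \<B>; A \<subseteq> B\<rbrakk> \<Longrightarrow> A = B"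
  proof (rule minimal_member_if_chains_closed)
    have "L \<in> \<B>"
      using L(1) by (intro in\<B> subset_set_mult_left Ld Rd order_refl)
    then show "\<B> \<noteq> {}" by blast
  next
    fix \<C> assume \<C>: "\<C> \<noteq> {}" "\<C> \<subseteq> \<B>" "\<forall>A\<in>\<C>. \<forall>B\<in>\<C>. A \<subseteq> B \<or> B \<subseteq> A"
    then have cn: "closed_normal G T B" "B \<subseteq> L" "B <#> R = L" if "B \<in> \<C>" for B
      using that by (auto simp: \<B>_def)
    show "\<Inter>\<C> \<in> \<B>"
    proof (rule in\<B>)
      show "closed_normal G T (\<Inter>\<C>)" using \<C>(1) cn by (intro closed_normal_Inter)
      show "\<Inter>\<C> \<subseteq> L" using \<C>(1) cn by blast
      show "L \<subseteq> \<Inter>\<C> <#> R"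
      proof
        fix x assume x: "x \<in> L"
        then have xc: "x \<in> carrier G" using Ld by blast
        \<comment> \<open>These are the possible left factors of \<open>x\<close> in
          \<open>B <#> R\<close>. As \<open>B\<close> runs through the chain they form a chain of
          non-empty closed sets, and a common point factorises \<open>x\<close> over the
          intersection.\<close>
        let ?K = "\<lambda>B. B \<inter> {b \<in> carrier G. inv b \<otimes> x \<in> R}"
        have "\<Inter>(?K ` \<C>) \<noteq> {}"
        proof (rule chain_closed_Inter_nonempty)
          show "?K ` \<C> \<noteq> {}" using \<C>(1) by simp
          fix K assume "K \<in> ?K ` \<C>"
          then obtain B where BC: "B \<in> \<C>" "K = ?K B" by blast
          have "closedin T K"
            unfolding BC(2) using cn[OF BC(1)] xc
            by (intro closedin_Int closed_normalD(2) closedin_preimage continuous_intros_group Rd) auto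
          moreover obtain b r where br: "b \<in> B" "r \<in> R" "x = b \<otimes> r"
            using x cn(3)[OF BC(1)] by (auto elim: set_multE)
          then have "b \<in> carrier G" "r \<in> carrier G"
            using closed_normalD(4)[OF cn(1)[OF BC(1)]] Rd by blast+
          then have "b \<in> K" unfolding BC(2) using br by simp
          ultimately show "closedin T K \<and> K \<noteq> {}" by blast
        next
          fix C D assume "C \<in> ?K ` \<C>" "D \<in> ?K ` \<C>"
          then obtain A B where "A \<in> \<C>" "B \<in> \<C>" "C = ?K A" "D = ?K B" by blast
          moreover then have "A \<subseteq> B \<or> B \<subseteq> A" using \<C>(3) by blast
          ultimately show "C \<subseteq> D \<or> D \<subseteq> C" by blast
        qed
        then obtain b where b: "b \<in> \<Inter>\<C>" "b \<in> carrier G" "inv b \<otimes> x \<in> R"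
          using \<C>(1) by blast
        then have "b \<otimes> (inv b \<otimes> x) \<in> \<Inter>\<C> <#> R" by (intro set_multI)
        then show "x \<in> \<Inter>\<C> <#> R" using b xc by simp
      qed
    qed
  qed blast
  have Bc: "closed_normal G T B" "B \<subseteq> L" "B <#> R = L" using B by (auto simp: \<B>_def)
  note Bd = closed_normalD[OF Bc(1)]
  show thesis
  proof
    show "closed_normal G T (B \<inter> R)" by (rule closed_normal_Int[OF Bc(1) R(1)])
    show "B \<inter> R \<subseteq> L" using R(2) by blast
    show "B \<inter> R \<noteq> {\<one>}"
    proof
      assume triv: "B \<inter> R = {\<one>}"
      have "B \<noteq> {\<one>}"
      proof
        assume "B = {\<one>}"
        then have "L = R" using Bc(3) Rd(4) by (force simp: set_mult_def)
        then show False using R(3) by simp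
      qed
      then obtain V where V: "open_normal G T V" "lcs (Suc c) V \<subseteq> B"
        using quot_vn[OF Bc(1)] by blast
      \<comment> \<open>Intersecting with \<open>U\<close> forces the term into
        \<open>L \<inter> U\<close> and thus into \<open>R\<close>; as it cannot be trivial, neither
        can \<open>B \<inter> R\<close>.\<close>
      have VU: "open_normal G T (V \<inter> U)" by (rule open_normal_Int[OF V(1) U(1)])
      note VUc = open_normal_imp_closed_normal[OF VU]
      have "lcs (Suc c) (V \<inter> U) \<subseteq> lcs (Suc c) V" by (intro lcs_mono) blast
      moreover have "lcs (Suc c) (V \<inter> U) \<subseteq> U" using lcs_subset[OF VUc] by blast
      ultimately have "lcs (Suc c) (V \<inter> U) \<subseteq> B \<inter> R" using V(2) U(2) Bc(2) by blast
      moreover have "\<one> \<in> lcs (Suc c) (V \<inter> U)" by (intro closed_normalD closed_normal_lcs VUc)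
      ultimately show False using not_vn[OF VU] triv by blast
    qed
    fix A assume A: "closed_normal G T A" "A \<subseteq> L" "A <#> (B \<inter> R) = L"
    note AB = closed_normal_closed_commutator[OF A(1) Bc(1)]
    have "L \<subseteq> A <#> R" using A(3) mono_set_mult[of A A "B \<inter> R" R] by auto
    moreover have "A <#> R \<subseteq> L" using A(2) R(2) Ld(3) by (rule set_mult_subset_subgroup)
    ultimately have AR: "A <#> R = L" by blast
    have "closed_commutator G T A B \<in> \<B>"
    proof (rule in\<B>[OF AB])
      show "closed_commutator G T A B \<subseteq> L"
        using closed_commutator_subset_left[OF A(1) Bd(4)] A(2) by blast
      let ?W = "closed_commutator G T A B <#> R"
      note W = closed_normalD[OF closed_normal_set_mult[OF AB R(1)]]
      have "closed_commutator G T L L \<subseteq> ?W"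
        using closed_commutator_set_mult_subset[OF A(1) Bc(1) R(1)] unfolding AR Bc(3) .
      moreover have "R \<subseteq> ?W" by (intro subset_set_mult_right Rd closed_normalD(5)[OF AB])
      ultimately have "closed_commutator G T L L <#> R \<subseteq> ?W"
        using W(3) by (rule set_mult_subset_subgroup)
      then show "L \<subseteq> ?W" using R(4) by simp
    qed
    then have "closed_commutator G T A B = B"
      using B_min closed_commutator_subset_right[OF closed_normalD(4)[OF A(1)] Bc(1)] by blast
    then have "B \<inter> R \<subseteq> A"
      using closed_commutator_subset_left[OF A(1) Bd(4)] by blast
    then have "L \<subseteq> A"
      using A(3) set_mult_subset_subgroup[of A A "B \<inter> R"] closed_normalD(3)[OF A(1)] by blast
    then show "A = L" using A(2) by blast
  qed
next
  case False
  note Ld = closed_normalD[OF L(1)]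
  let ?N = "closed_commutator G T L L"
  have N: "closed_normal G T ?N" by (rule closed_normal_closed_commutator[OF L(1) L(1)])
  have NL: "?N \<subseteq> L" by (rule closed_commutator_subset_left[OF L(1) Ld(4)])
  show thesis
  proof
    show "closed_normal G T ?N" "?N \<subseteq> L" by fact+
    show "?N \<noteq> {\<one>}" using lcs_nontrivial[OF no_abelian L, of "Suc (Suc 0)"] by simp
    fix A assume A: "closed_normal G T A" "A \<subseteq> L" "A <#> ?N = L"
    show "A = L"
    proof (rule ccontr)
      assume "A \<noteq> L"
      \<comment> \<open>Enlarging \<open>A\<close> to a proper, relatively open \<open>R\<close>
        still gives \<open>[L, L] R = L\<close>, which the present case excludes.\<close>
      then obtain R U where R: "closed_normal G T R" "open_normal G T U" "A \<subseteq> R" "R \<subseteq> L" "R \<noteq> L"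
          "L \<inter> U \<subseteq> R"
        using ex_proper_relatively_open_normal[OF L(1) A(1,2)] by blast
      note W = closed_normalD[OF closed_normal_set_mult[OF N R(1)]]
      have "A \<subseteq> ?N <#> R"
        using R(3) subset_set_mult_right[OF closed_normalD(4)[OF R(1)] closed_normalD(5)[OF N]] by blast
      moreover have "?N \<subseteq> ?N <#> R"
        by (intro subset_set_mult_left closed_normalD(4)[OF N] closed_normalD(5)[OF R(1)])
      ultimately have "A <#> ?N \<subseteq> ?N <#> R" using W(3) by (rule set_mult_subset_subgroup)
      then have "L \<subseteq> ?N <#> R" using A(3) by simp
      moreover have "?N <#> R \<subseteq> L" using NL R(4) Ld(3) by (rule set_mult_subset_subgroup)
      ultimately show False using False R by blast
    qed
  qed
qed

section \<open>The two implications of the equivalence\<close>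

lemma finite_obliquity_if_JNNF:
  assumes fg: "topologically_fg G T"
    and not_vn: "\<And>V. open_normal G T V \<Longrightarrow> lcs (Suc c) V \<noteq> {\<one>}"
    and quot_vn: "\<And>N. \<lbrakk>closed_normal G T N; N \<noteq> {\<one>}\<rbrakk> \<Longrightarrow> \<exists>V. open_normal G T V \<and> lcs (Suc c) V \<subseteq> N"
    and no_abelian:
      "\<not> (\<exists>N. closed_normal G T N \<and> (\<forall>x\<in>N. \<forall>y\<in>N. x \<otimes> y = y \<otimes> x) \<and> N \<noteq> {\<one>})"
    and H: "subgroup H G" "openin T H"
  shows "finite {lcs (Suc c) K |K. open_normal G T K \<and> \<not> lcs (Suc c) K \<subseteq> H}" (is "finite ?\<A>")
proof (rule ccontr)
  assume inf: "infinite ?\<A>"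
  define \<A> where "\<A> = ?\<A>"
  have \<A>: "closed_normal G T A" "\<not> A \<subseteq> H" if "A \<in> \<A>" for A
    using that closed_normal_lcs[OF open_normal_imp_closed_normal] by (auto simp: \<A>_def simp del: lower_central.simps)
  have fin: "finite ((\<lambda>A. A <#> N) ` \<A>)" if N: "closed_normal G T N" "N \<noteq> {\<one>}" for N
  proof -
    obtain V where V: "open_normal G T V" "lcs (Suc c) V \<subseteq> N" using quot_vn[OF N] by blast
    show ?thesis
      by (rule finite_subset[OF _ finite_lcs_values[OF fg V(1) N(1) V(2)]])
        (use open_normal_imp_closed_normal in \<open>auto simp: \<A>_def simp del: lower_central.simps\<close>)
  qed
  \<comment> \<open>The family to be minimised. Its members are not contained in \<open>H\<close>,
    hence non-trivial, which makes \<open>fin\<close> applicable to them.\<close>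
  define \<L> where "\<L> = {L. closed_normal G T L \<and> infinite {A \<in> \<A>. A \<subseteq> L}}"
  have \<L>_H: "\<not> L \<subseteq> H" if "L \<in> \<L>" for L
  proof -
    have "{A \<in> \<A>. A \<subseteq> L} \<noteq> {}" using that infinite_imp_nonempty by (auto simp: \<L>_def)
    then show ?thesis using \<A>(2) by blast
  qed
  have nontrivial: "L \<noteq> {\<one>}" if "\<not> L \<subseteq> H" for L
    using that subgroup.one_closed[OF H(1)] by blast
  obtain L where L: "L \<in> \<L>" and L_min: "\<And>A. \<lbrakk>A \<in> \<L>; A \<subseteq> L\<rbrakk> \<Longrightarrow> A = L"
  proof (rule minimal_member_if_chains_closed)
    have "{A \<in> \<A>. A \<subseteq> carrier G} = \<A>" using \<A>(1) closed_normalD(4) by blast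
    then have "carrier G \<in> \<L>"
      using inf closed_normal_carrier by (simp add: \<L>_def \<A>_def del: lower_central.simps)
    then show "\<L> \<noteq> {}" by blast
  next
    fix \<C> assume \<C>: "\<C> \<noteq> {}" "\<C> \<subseteq> \<L>" "\<forall>A\<in>\<C>. \<forall>B\<in>\<C>. A \<subseteq> B \<or> B \<subseteq> A"
    have cn: "closed_normal G T C" if "C \<in> \<C>" for C using that \<C>(2) by (auto simp: \<L>_def)
    define L where "L = \<Inter>\<C>"
    have Lc: "closed_normal G T L" unfolding L_def using \<C>(1) cn by (rule closed_normal_Inter)
    \<comment> \<open>\<open>H\<close> is open, so the sets \<open>C - H\<close> are closed and
      compactness prevents the intersection of the chain from falling into \<open>H\<close>; in
      particular \<open>L\<close> is non-trivial.\<close>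
    have "\<Inter>((\<lambda>C. C - H) ` \<C>) \<noteq> {}"
    proof (rule chain_closed_Inter_nonempty)
      show "(\<lambda>C. C - H) ` \<C> \<noteq> {}" using \<C>(1) by simp
      show "closedin T D \<and> D \<noteq> {}" if "D \<in> (\<lambda>C. C - H) ` \<C>" for D
        using that cn closed_normalD(2) H(2) \<L>_H \<C>(2) by (auto intro!: closedin_diff)
      show "C \<subseteq> D \<or> D \<subseteq> C" if "C \<in> (\<lambda>C. C - H) ` \<C>" "D \<in> (\<lambda>C. C - H) ` \<C>" for C D
        using that \<C>(3) by blast
    qed
    then have LH: "\<not> L \<subseteq> H" using \<C>(1) by (auto simp: L_def)
    \<comment> \<open>By \<open>fin\<close> only finitely many products \<open>A <#> L\<close> are
      not inside \<open>L\<close>. Each of them is excluded by some member of the chain, so a single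
      \<open>C\<close> excludes them all; every \<open>A\<close> inside this \<open>C\<close> is
      then already inside \<open>L\<close>.\<close>
    define \<B> where "\<B> = {B \<in> (\<lambda>A. A <#> L) ` \<A>. \<not> B \<subseteq> L}"
    have "finite \<B>" unfolding \<B>_def using fin[OF Lc nontrivial[OF LH]] by simp
    moreover have "\<forall>B\<in>\<B>. \<exists>C\<in>\<C>. \<not> B \<subseteq> C" unfolding \<B>_def L_def by blast
    ultimately have "\<exists>C\<in>\<C>. \<forall>B\<in>\<B>. \<not> B \<subseteq> C"
    proof (induction \<B> rule: finite_induct)
      case empty then show ?case using \<C>(1) by blast
    next
      case (insert B \<B>)
      then obtain C D where "C \<in> \<C>" "\<forall>B\<in>\<B>. \<not> B \<subseteq> C" "D \<in> \<C>" "\<not> B \<subseteq> D" by auto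
      moreover then have "C \<subseteq> D \<or> D \<subseteq> C" using \<C>(3) by blast
      ultimately show ?case by blast
    qed
    then obtain C where C: "C \<in> \<C>" "\<And>B. B \<in> \<B> \<Longrightarrow> \<not> B \<subseteq> C" by blast
    have "A \<subseteq> L" if "A \<in> \<A>" "A \<subseteq> C" for A
    proof (rule ccontr)
      assume "\<not> A \<subseteq> L"
      moreover have "A \<subseteq> A <#> L"
        using closed_normalD(4)[OF \<A>(1)[OF that(1)]] closed_normalD(5)[OF Lc] by (rule subset_set_mult_left)
      ultimately have "A <#> L \<in> \<B>" using that(1) by (auto simp: \<B>_def)
      moreover have "L \<subseteq> C" using C(1) by (auto simp: L_def)
      then have "A <#> L \<subseteq> C"
        using that(2) closed_normalD(3)[OF cn[OF C(1)]] by (intro set_mult_subset_subgroup)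
      ultimately show False using C(2) by blast
    qed
    then have "{A \<in> \<A>. A \<subseteq> C} \<subseteq> {A \<in> \<A>. A \<subseteq> L}" by blast
    moreover have "infinite {A \<in> \<A>. A \<subseteq> C}" using C(1) \<C>(2) by (auto simp: \<L>_def)
    ultimately show "\<Inter>\<C> \<in> \<L>"
      using Lc finite_subset unfolding \<L>_def L_def by blast
  qed blast
  have Lc: "closed_normal G T L" and Linf: "infinite {A \<in> \<A>. A \<subseteq> L}" using L by (auto simp: \<L>_def)
  obtain N where N: "closed_normal G T N" "N \<noteq> {\<one>}" "N \<subseteq> L"
      "\<And>A. \<lbrakk>closed_normal G T A; A \<subseteq> L; A <#> N = L\<rbrakk> \<Longrightarrow> A = L"
    using ex_non_supplemented[OF not_vn quot_vn no_abelian Lc nontrivial[OF \<L>_H[OF L]]] by blast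
  have "finite ((\<lambda>A. A <#> N) ` {A \<in> \<A>. A \<subseteq> L})"
    by (rule finite_subset[OF _ fin[OF N(1,2)]]) blast
  \<comment> \<open>Infinitely many \<open>A\<close> share finitely many values
    \<open>A <#> N\<close>, so one value occurs infinitely often.\<close>
  then obtain A0 where A0: "A0 \<in> \<A>" "A0 \<subseteq> L"
      and infA: "infinite {A \<in> {A \<in> \<A>. A \<subseteq> L}. A <#> N = A0 <#> N}"
    using pigeonhole_infinite[OF Linf] by blast
  let ?B = "A0 <#> N"
  have B: "closed_normal G T ?B" by (rule closed_normal_set_mult[OF \<A>(1)[OF A0(1)] N(1)])
  have BL: "?B \<subseteq> L" using A0(2) N(3) closed_normalD(3)[OF Lc] by (rule set_mult_subset_subgroup)
  have "A \<subseteq> ?B" if "A \<in> \<A>" "A <#> N = ?B" for A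
    using subset_set_mult_left[OF closed_normalD(4)[OF \<A>(1)[OF that(1)]] closed_normalD(5)[OF N(1)]]
      that(2) by simp
  then have "{A \<in> {A \<in> \<A>. A \<subseteq> L}. A <#> N = ?B} \<subseteq> {A \<in> \<A>. A \<subseteq> ?B}" by blast
  \<comment> \<open>Minimality of \<open>L\<close> will give \<open>?B = L\<close>; then the choice
    of \<open>N\<close> forces each \<open>A\<close> in this infinite set to equal \<open>L\<close>,
    a contradiction.\<close>
  then have "?B \<in> \<L>" unfolding \<L>_def using infA B finite_subset by blast
  then have "?B = L" using L_min BL by blast
  then have "{A \<in> {A \<in> \<A>. A \<subseteq> L}. A <#> N = ?B} \<subseteq> {L}" using N(4) \<A>(1) by auto
  then show False using infA finite_subset by blast
qed

lemma JNNF_if_finite_obliquity: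
  assumes inf: "infinite (carrier G)"
    and no_abelian:
      "\<not> (\<exists>N. closed_normal G T N \<and> (\<forall>x\<in>N. \<forall>y\<in>N. x \<otimes> y = y \<otimes> x) \<and> N \<noteq> {\<one>})"
    and fin: "\<And>H. open_subgroup G T H \<Longrightarrow>
      finite {lcs (Suc c) K |K. open_normal G T K \<and> \<not> lcs (Suc c) K \<subseteq> H}"
  shows "JNNF c G T"
  unfolding JNNF_def
proof (intro conjI allI impI; (elim conjE)?)
  show "\<not> virtually_nilpotent c G T"
  proof
    assume "virtually_nilpotent c G T"
    then obtain V where V: "open_normal G T V" "lcs (Suc c) V = {\<one>}"
      unfolding virtually_nilpotent_iff by blast
    \<comment> \<open>A trivial term forces \<open>V\<close> itself to be trivial; as
      \<open>V\<close> is open, \<open>G\<close> would be finite.\<close>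
    then have "V = {\<one>}"
      using lcs_nontrivial[OF no_abelian open_normal_imp_closed_normal[OF V(1)]] by blast
    then obtain F where "finite F" "carrier G = F <#> {\<one>}"
      using finite_cover_open_subgroup open_normalD(2,4)[OF V(1)] by metis
    then show False using inf finite_set_mult by auto
  qed
next
  fix N assume N: "closed_normal G T N" "N \<noteq> {\<one>}"
  note Nd = closed_normalD[OF N(1)]
  have D: "closed_normal G T (lcs (Suc c) N)" "lcs (Suc c) N \<noteq> {\<one>}"
    using closed_normal_lcs[OF N(1)] lcs_nontrivial[OF no_abelian N] by blast+
  then obtain x where x: "x \<in> lcs (Suc c) N" "x \<noteq> \<one>" using closed_normalD(5)[OF D(1)] by blast
  \<comment> \<open>\<open>H\<close> is chosen to miss a non-trivial element of
    \<open>lcs (Suc c) N\<close>. No \<open>K\<close> above \<open>N\<close> then has its term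
    inside \<open>H\<close>, so the finiteness assumption covers all of \<open>\<K>\<close>.\<close>
  then obtain H where H: "open_normal G T H" "x \<notin> {\<one>} <#> H"
    using separate_by_open_normal[OF closedin_one, of x] closed_normalD(4)[OF D(1)] by blast
  then have xH: "x \<notin> H"
    using subset_set_mult_right[of H "{\<one>}"] open_normalD(5)[OF H(1)] by blast
  define \<K> where "\<K> = {K. open_normal G T K \<and> N \<subseteq> K}"
  have "lcs (Suc c) ` \<K> \<subseteq> {lcs (Suc c) K |K. open_normal G T K \<and> \<not> lcs (Suc c) K \<subseteq> H}"
    using lcs_mono[of N _ "Suc c"] x(1) xH by (auto simp: \<K>_def simp del: lower_central.simps)
  moreover have "open_subgroup G T H" using open_normalD[OF H(1)] by (simp add: open_subgroup_def)
  ultimately have "finite (lcs (Suc c) ` \<K>)" using fin finite_subset by blast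
  then obtain \<F> where \<F>: "\<F> \<subseteq> \<K>" "finite \<F>" "lcs (Suc c) ` \<K> = lcs (Suc c) ` \<F>"
    by (metis finite_subset_image order_refl)
  \<comment> \<open>The intersection with \<open>carrier G\<close> matters for the empty family,
    whose intersection is the whole type.\<close>
  have "open_normal G T (carrier G \<inter> \<Inter>\<F>) \<and> N \<subseteq> carrier G \<inter> \<Inter>\<F>"
    using \<F>(2,1)
  proof (induction \<F> rule: finite_induct)
    case empty then show ?case using open_normal_carrier Nd(4) by simp
  next
    case (insert K \<F>)
    have "carrier G \<inter> \<Inter>(insert K \<F>) = K \<inter> (carrier G \<inter> \<Inter>\<F>)" by blast
    then show ?case using insert open_normal_Int by (auto simp: \<K>_def)
  qed
  then obtain V where V: "open_normal G T V" "V \<subseteq> \<Inter>\<F>" by blast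
  \<comment> \<open>Each value on \<open>\<K>\<close> is attained on \<open>\<F>\<close>, and
    \<open>V\<close> lies inside every member of \<open>\<F>\<close>.\<close>
  have below: "lcs (Suc c) V \<subseteq> K" if "K \<in> \<K>" for K
  proof -
    have "lcs (Suc c) K \<in> lcs (Suc c) ` \<F>" unfolding \<F>(3)[symmetric] using that by (rule imageI)
    then obtain K' where K': "K' \<in> \<F>" "lcs (Suc c) K = lcs (Suc c) K'" by (rule imageE)
    have "lcs (Suc c) V \<subseteq> lcs (Suc c) K'" using V(2) K'(1) by (intro lcs_mono) blast
    also have "\<dots> \<subseteq> K"
      using K'(2) that lcs_subset[of K "Suc c"] open_normal_imp_closed_normal by (auto simp: \<K>_def simp del: lower_central.simps)
    finally show ?thesis .
  qed
  \<comment> \<open>\<open>N\<close> is closed, hence the intersection of the groups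
    \<open>N <#> U\<close> with \<open>U\<close> open normal, all of which belong to
    \<open>\<K>\<close>.\<close>
  have "lcs (Suc c) V \<subseteq> N"
  proof
    fix x assume x: "x \<in> lcs (Suc c) V"
    then have xc: "x \<in> carrier G"
      using lcs_subset[OF open_normal_imp_closed_normal[OF V(1)]] open_normalD(5)[OF V(1)] by blast
    show "x \<in> N"
    proof (rule ccontr)
      assume "x \<notin> N"
      then obtain U where U: "open_normal G T U" "x \<notin> N <#> U"
        using separate_by_open_normal[OF Nd(2) xc] by blast
      have "N \<subseteq> N <#> U" using Nd(4) open_normalD(6)[OF U(1)] by (rule subset_set_mult_left)
      then have "N <#> U \<in> \<K>" using open_normal_set_mult[OF N(1) U(1)] by (simp add: \<K>_def)
      then show False using below x U(2) by blast
    qed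
  qed
  then show "virtually_nilpotent c (G Mod N) (quotient_topology G T N)"
    unfolding virtually_nilpotent_quotient_iff[OF N(1)] using V(1) by blast
qed

end

theorem theorem2:
  fixes G :: "('a, 'b) monoid_scheme" (structure)
    and T :: "'a topology"
    and c :: nat
  assumes "profinite_group G T"
    and "topologically_fg G T"
    and "infinite (carrier G)"
    and "\<not> (\<exists>N. closed_normal G T N \<and> (\<forall>x\<in>N. \<forall>y\<in>N. x \<otimes> y = y \<otimes> x) \<and> N \<noteq> {\<one>})"
  shows "JNNF c G T \<longleftrightarrow>
    (\<forall>H. open_subgroup G T H \<longrightarrow>
       finite {lower_central G T (c + 1) K | K.
                 open_normal G T K \<and> \<not> lower_central G T (c + 1) K \<subseteq> H})"
proof -
  interpret profinite_group G T by fact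
  have "finite {lcs (Suc c) K |K. open_normal G T K \<and> \<not> lcs (Suc c) K \<subseteq> H}"
    if J: "JNNF c G T" and H: "open_subgroup G T H" for H
  proof (rule finite_obliquity_if_JNNF[OF assms(2) _ _ assms(4)])
    show "lcs (Suc c) V \<noteq> {\<one>}" if "open_normal G T V" for V
      using J that by (auto simp: JNNF_def virtually_nilpotent_iff)
    show "\<exists>V. open_normal G T V \<and> lcs (Suc c) V \<subseteq> N" if "closed_normal G T N" "N \<noteq> {\<one>}" for N
      using J that virtually_nilpotent_quotient_iff[OF that(1)] unfolding JNNF_def by blast
  qed (use H in \<open>auto simp: open_subgroup_def\<close>)
  then show ?thesis
    unfolding Suc_eq_plus1[symmetric] using JNNF_if_finite_obliquity[OF assms(3,4)] by blast
qed

end
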